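(* There is no edge-transitive Woolly Hat graph. That is, for every integer $n\ge 3$ and all $a,b,c,d\in\mathbb{Z}_n$ for which $\mathrm{WH}_n(a,b,c,d)$ is defined, the automorphism group of $\mathrm{WH}_n(a,b,c,d)$ does not act transitively on its edge set.
   Context: For an integer $n\ge 3$ and $a,b,c,d\in\mathbb{Z}_n$ with $2a\neq 0$, $b,c,d$ pairwise distinct, and such that no prime divides $n$ together with (integer representatives of) all of $a,b,c,d$, the Woolly Hat graph $\mathrm{WH}_n(a,b,c,d)$ is the graph with vertex set $\{A_i,B_i,C_i : i\in\mathbb{Z}_n\}$ (of order $3n$) with adjacencies, for each $i\in\mathbb{Z}_n$ (subscripts mod $n$): $A_i\sim A_{i-a},A_{i+a},B_i,C_i$; $B_i\sim A_i,C_{i+b},C_{i+c},C_{i+d}$; $C_i\sim A_i,B_{i-b},B_{i-c},B_{i-d}$. Such a graph is connected and $4$-valent. A graph is edge-transitive if its automorphism group acts transitively on its edges. *)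

theory Defs
  imports "HOL-Number_Theory.Cong" "HOL-Computational_Algebra.Primes" "HOL-Algebra.Group_Action"
begin

text \<open>A simple graph is given by its vertex set and its set of edges, an edge being the
  two-element set of its ends.\<close>

definition simple_graph :: "'v set \<Rightarrow> 'v set set \<Rightarrow> bool" where
  "simple_graph V E \<longleftrightarrow> (\<forall>e\<in>E. \<exists>u\<in>V. \<exists>v\<in>V. u \<noteq> v \<and> e = {u, v})"

definition graph_auts :: "'v set \<Rightarrow> 'v set set \<Rightarrow> ('v \<Rightarrow> 'v) set" where
  "graph_auts V E = {g \<in> Bij V. \<forall>u\<in>V. \<forall>v\<in>V. {g u, g v} \<in> E \<longleftrightarrow> {u, v} \<in> E}"

definition AutGraph :: "'v set \<Rightarrow> 'v set set \<Rightarrow> ('v \<Rightarrow> 'v) monoid" where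
  "AutGraph V E = BijGroup V \<lparr>carrier := graph_auts V E\<rparr>"

definition edge_transitive :: "'v set \<Rightarrow> 'v set set \<Rightarrow> bool" where
  "edge_transitive V E \<longleftrightarrow> (\<forall>e\<in>E. \<forall>f\<in>E. \<exists>g\<in>carrier (AutGraph V E). g ` e = f)"

text \<open>The vertices \<open>A i\<close>, \<open>B i\<close>, \<open>C i\<close> with \<open>i \<in> {0..<n}\<close> are those of the Woolly Hat graph
  for the modulus \<open>n\<close>. The parameters are arbitrary integer representatives of residue classes:
  the graph depends on them only modulo \<open>n\<close>.\<close>

datatype wh_vertex = A int | B int | C int

definition WH_verts :: "int \<Rightarrow> wh_vertex set" where
  "WH_verts n = A ` {0..<n} \<union> B ` {0..<n} \<union> C ` {0..<n}"

fun WH_nbrs :: "int \<Rightarrow> int \<Rightarrow> int \<Rightarrow> int \<Rightarrow> int \<Rightarrow> wh_vertex \<Rightarrow> wh_vertex set" where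
  "WH_nbrs n a b c d (A i) = {A ((i - a) mod n), A ((i + a) mod n), B i, C i}"
| "WH_nbrs n a b c d (B i) = {A i, C ((i + b) mod n), C ((i + c) mod n), C ((i + d) mod n)}"
| "WH_nbrs n a b c d (C i) = {A i, B ((i - b) mod n), B ((i - c) mod n), B ((i - d) mod n)}"

definition WH_edges :: "int \<Rightarrow> int \<Rightarrow> int \<Rightarrow> int \<Rightarrow> int \<Rightarrow> wh_vertex set set" where
  "WH_edges n a b c d = {{u, v} | u v. u \<in> WH_verts n \<and> v \<in> WH_nbrs n a b c d u}"

text \<open>The conditions under which \<open>WH\<^sub>n(a,b,c,d)\<close> is defined.\<close>

definition WH_params :: "int \<Rightarrow> int \<Rightarrow> int \<Rightarrow> int \<Rightarrow> int \<Rightarrow> bool" where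
  "WH_params n a b c d \<longleftrightarrow>
     n \<ge> 3 \<and> \<not> [2 * a = 0] (mod n) \<and>
     \<not> [b = c] (mod n) \<and> \<not> [b = d] (mod n) \<and> \<not> [c = d] (mod n) \<and>
     \<not> (\<exists>p::int. prime p \<and> p dvd n \<and> p dvd a \<and> p dvd b \<and> p dvd c \<and> p dvd d)"

lemma group_AutGraph: "group (AutGraph V E)"
proof -
  interpret S: group "BijGroup V" by (rule group_BijGroup)
  have "subgroup (graph_auts V E) (BijGroup V)"
  proof (rule S.subgroupI)
    show "graph_auts V E \<subseteq> carrier (BijGroup V)"
      by (auto simp: graph_auts_def BijGroup_def)
    have "(\<lambda>x\<in>V. x) \<in> graph_auts V E"
      by (auto simp: graph_auts_def id_Bij)
    then show "graph_auts V E \<noteq> {}" by blast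
  next
    fix g assume g: "g \<in> graph_auts V E"
    then have gB: "g \<in> Bij V" by (simp add: graph_auts_def)
    then have bij: "bij_betw g V V" by (simp add: Bij_def)
    have "{inv_into V g u, inv_into V g v} \<in> E \<longleftrightarrow> {u, v} \<in> E" if "u \<in> V" "v \<in> V" for u v
    proof -
      have "inv_into V g u \<in> V" "inv_into V g v \<in> V"
        using gB that by (auto intro: Bij_inv_into_mem)
      moreover have "g (inv_into V g u) = u" "g (inv_into V g v) = v"
        using bij that by (auto intro: bij_betw_inv_into_right)
      ultimately show ?thesis
        using g unfolding graph_auts_def by fastforce
    qed
    then show "inv\<^bsub>BijGroup V\<^esub> g \<in> graph_auts V E"
      using gB by (simp add: inv_BijGroup graph_auts_def restrict_inv_into_Bij)
  next
    fix g h assume gh: "g \<in> graph_auts V E" "h \<in> graph_auts V E"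
    then have B: "g \<in> Bij V" "h \<in> Bij V" by (auto simp: graph_auts_def)
    have "h u \<in> V" if "u \<in> V" for u
      using B(2) that Bij_imp_funcset by fastforce
    then have "compose V g h \<in> graph_auts V E"
      using gh by (auto simp: graph_auts_def compose_Bij compose_eq)
    then show "g \<otimes>\<^bsub>BijGroup V\<^esub> h \<in> graph_auts V E"
      using B by (simp add: BijGroup_def)
  qed
  then show ?thesis
    unfolding AutGraph_def by (rule S.subgroup_imp_group)
qed

lemma group_action_AutGraph_edges:
  assumes "simple_graph V E"
  shows "group_action (AutGraph V E) E (\<lambda>g. \<lambda>e\<in>E. g ` e)"
proof -
  have sub: "e \<subseteq> V" if "e \<in> E" for e
    using assms that by (auto simp: simple_graph_def)
  have img: "g ` e \<in> E" if g: "g \<in> graph_auts V E" and e: "e \<in> E" for g e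
  proof -
    obtain u v where "u \<in> V" "v \<in> V" "e = {u, v}"
      using assms e unfolding simple_graph_def by meson
    then show ?thesis using g e by (simp add: graph_auts_def)
  qed
  have Bij_E: "(\<lambda>e\<in>E. g ` e) \<in> Bij E" if g: "g \<in> graph_auts V E" for g
  proof -
    have bij: "bij_betw g V V" using g by (simp add: graph_auts_def Bij_def)
    then have inj: "inj_on g V" by (simp add: bij_betw_def)
    have "inj_on ((`) g) E"
      using inj sub by (meson inj_onI inj_on_image_eq_iff)
    moreover have "(`) g ` E = E"
    proof (intro equalityI subsetI)
      fix f assume f: "f \<in> E"
      then obtain u v where uv: "u \<in> V" "v \<in> V" "f = {u, v}"
        using assms unfolding simple_graph_def by meson
      then obtain x y where xy: "x \<in> V" "y \<in> V" "g x = u" "g y = v"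
        using bij by (metis bij_betw_def imageE)
      then have "{x, y} \<in> E"
        using g f uv by (auto simp: graph_auts_def)
      moreover have "f = g ` {x, y}" using uv xy by simp
      ultimately show "f \<in> (`) g ` E" by blast
    qed (use img g in blast)
    ultimately have "bij_betw ((`) g) E E" by (simp add: bij_betw_def)
    then show ?thesis by (simp add: Bij_def)
  qed
  have "(\<lambda>e\<in>E. compose V g h ` e) = compose E (\<lambda>e\<in>E. g ` e) (\<lambda>e\<in>E. h ` e)"
    if "g \<in> graph_auts V E" "h \<in> graph_auts V E" for g h
  proof
    fix e
    show "(\<lambda>e\<in>E. compose V g h ` e) e = compose E (\<lambda>e\<in>E. g ` e) (\<lambda>e\<in>E. h ` e) e"
    proof (cases "e \<in> E")
      case True
      then have "compose V g h ` e = g ` h ` e"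
        using sub[of e] by (force simp: compose_def image_image)
      with True show ?thesis using img that by (simp add: compose_eq)
    qed (simp add: compose_def)
  qed
  then have "(\<lambda>g. \<lambda>e\<in>E. g ` e) \<in> hom (AutGraph V E) (BijGroup E)"
    using Bij_E by (auto simp: hom_def AutGraph_def BijGroup_def graph_auts_def)
  then show ?thesis
    by (simp add: group_action_def group_hom_def group_hom_axioms_def group_AutGraph group_BijGroup)
qed

lemma edge_transitive_iff_transitive_action:
  assumes "simple_graph V E"
  shows "edge_transitive V E \<longleftrightarrow> transitive_action (AutGraph V E) E (\<lambda>g. \<lambda>e\<in>E. g ` e)"
  using group_action_AutGraph_edges[OF assms]
  by (auto simp: edge_transitive_def transitive_action_def transitive_action_axioms_def)

lemma simple_graph_WH:
  assumes "WH_params n a b c d"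
  shows "simple_graph (WH_verts n) (WH_edges n a b c d)"
proof -
  have n: "n \<ge> 3" and "\<not> n dvd 2 * a"
    using assms by (auto simp: WH_params_def cong_0_iff)
  then have a: "\<not> n dvd a" by (meson dvd_mult)
  have "(i - a) mod n \<noteq> i" "(i + a) mod n \<noteq> i" for i
    using a by (metis add_diff_cancel_left' mod_eq_dvd_iff mod_mod_trivial dvd_minus_iff
        diff_diff_eq2 minus_diff_eq diff_add_cancel add.commute)+
  moreover have "v \<in> WH_verts n" if "u \<in> WH_verts n" "v \<in> WH_nbrs n a b c d u" for u v
    using that n by (cases u) (auto simp: WH_verts_def)
  moreover have "v \<noteq> u" if "v \<in> WH_nbrs n a b c d u" for u v
    using that calculation(1,2) by (cases u) (auto, metis+)
  ultimately show ?thesis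
    unfolding simple_graph_def WH_edges_def by fast
qed

lemma card_WH_verts:
  assumes "n \<ge> 0"
  shows "int (card (WH_verts n)) = 3 * n"
proof -
  have "card (A ` {0..<n}) = nat n" "card (B ` {0..<n}) = nat n" "card (C ` {0..<n}) = nat n"
    by (auto simp: card_image inj_on_def)
  then have "card (WH_verts n) = 3 * nat n"
    unfolding WH_verts_def by (subst card_Un_disjoint; auto)+
  with assms show ?thesis by simp
qed

lemma WH_nbrs_sym:
  assumes "u \<in> WH_verts n" "v \<in> WH_verts n"
  shows "v \<in> WH_nbrs n a b c d u \<longleftrightarrow> u \<in> WH_nbrs n a b c d v"
  using assms by (cases u; cases v) (auto simp: WH_verts_def mod_simps)

end

theory Submission
  imports Defs
begin

text \<open>
  The reflection \<open>A i \<mapsto> A (b - i)\<close>, \<open>B i \<mapsto> C (b - i)\<close>, \<open>C i \<mapsto> B (b - i)\<close> reverses an edge, so an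
  edge-transitive Woolly Hat graph is arc-transitive. Then every symmetric automorphism-invariant
  weight of pairs of vertices takes the same value on complementary pairs of neighbours of a
  vertex, and the values at \<open>A 0\<close> occur at \<open>B 0\<close>. For the number of walks of length \<open>2\<close> this
  excludes cycles of length four. For walks of length \<open>4\<close>, the hexagons through \<open>B\<close>- and
  \<open>C\<close>-vertices force a hexagon through \<open>B 0, A 0, C 0\<close>, hence \<open>{b, c, d} = {x, -x, z}\<close>, and a
  hexagon through \<open>A (-a), A 0, A a\<close>, hence \<open>z = \<plusminus>3a\<close>, \<open>z = \<plusminus>x \<plusminus> 2a\<close> or \<open>2a = \<plusminus>2x\<close>. The
  remaining equations for walks of length \<open>4\<close> leave only \<open>{b, c, d} = {2z + a, 2z - a, z}\<close> with
  \<open>4z = 0\<close>. There a vertex is joined to its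
  translate by \<open>2z\<close> by exactly eight walks of length \<open>4\<close>; the parity of the number of such walks
  from one neighbour of a vertex to the translate of another one separates the complementary pairs
  \<open>{A (-a), A a}\<close> and \<open>{B 0, C 0}\<close>.
\<close>

section \<open>Automorphism-invariant weights and arc-transitivity in general graphs\<close>

definition nbhd :: "'v set \<Rightarrow> 'v set set \<Rightarrow> 'v \<Rightarrow> 'v set" where
  "nbhd V E u = {p \<in> V. {u, p} \<in> E}"

fun gwalks :: "'v set \<Rightarrow> 'v set set \<Rightarrow> nat \<Rightarrow> 'v \<Rightarrow> 'v \<Rightarrow> nat" where
  "gwalks V E 0 u v = of_bool (u = v)"
| "gwalks V E (Suc k) u v = (\<Sum>p\<in>nbhd V E u. gwalks V E k p v)"

definition invariant_weight :: "'v set \<Rightarrow> 'v set set \<Rightarrow> ('v \<Rightarrow> 'v \<Rightarrow> nat) \<Rightarrow> bool" where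
  "invariant_weight V E f \<longleftrightarrow>
     (\<forall>u\<in>V. \<forall>v\<in>V. f u v = f v u \<and> (\<forall>g\<in>graph_auts V E. f (g u) (g v) = f u v))"

definition arc_transitive :: "'v set \<Rightarrow> 'v set set \<Rightarrow> bool" where
  "arc_transitive V E \<longleftrightarrow>
     (\<forall>u\<in>V. \<forall>v\<in>nbhd V E u. \<forall>u'\<in>V. \<forall>v'\<in>nbhd V E u'. \<exists>g\<in>graph_auts V E. g u = u' \<and> g v = v')"

lemma nbhd_subset: "nbhd V E u \<subseteq> V"
  by (auto simp: nbhd_def)

lemma nbhd_sym: "u \<in> V \<Longrightarrow> p \<in> nbhd V E u \<Longrightarrow> u \<in> nbhd V E p"
  by (auto simp: nbhd_def insert_commute)

lemma graph_autsD:
  assumes "g \<in> graph_auts V E"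
  shows "bij_betw g V V" "\<And>u v. u \<in> V \<Longrightarrow> v \<in> V \<Longrightarrow> {g u, g v} \<in> E \<longleftrightarrow> {u, v} \<in> E"
    "\<And>u. u \<in> V \<Longrightarrow> g u \<in> V" "inj_on g V"
  using assms by (auto simp: graph_auts_def Bij_def bij_betw_def)

lemma graph_aut_nbhd:
  assumes g: "g \<in> graph_auts V E" and u: "u \<in> V"
  shows "bij_betw g (nbhd V E u) (nbhd V E (g u))"
proof -
  note gD = graph_autsD[OF g]
  have "nbhd V E (g u) \<subseteq> g ` nbhd V E u"
  proof
    fix q assume q: "q \<in> nbhd V E (g u)"
    then have "q \<in> g ` V" using gD(1) by (auto simp: nbhd_def bij_betw_def)
    then obtain p where p: "p \<in> V" "q = g p" by blast
    then have "p \<in> nbhd V E u" using q u gD(2) by (auto simp: nbhd_def)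
    with p show "q \<in> g ` nbhd V E u" by blast
  qed
  moreover have "g ` nbhd V E u \<subseteq> nbhd V E (g u)"
    using gD u by (auto simp: nbhd_def)
  moreover have "inj_on g (nbhd V E u)"
    using gD(4) nbhd_subset inj_on_subset by metis
  ultimately show ?thesis by (auto simp: bij_betw_def)
qed

lemma gwalks_graph_aut:
  assumes g: "g \<in> graph_auts V E" and "u \<in> V" "v \<in> V"
  shows "gwalks V E k (g u) (g v) = gwalks V E k u v"
  using assms(2)
proof (induction k arbitrary: u)
  case 0
  then show ?case using graph_autsD(4)[OF g] \<open>v \<in> V\<close> by (auto simp: inj_on_def)
next
  case (Suc k)
  have "gwalks V E (Suc k) (g u) (g v) = (\<Sum>p\<in>nbhd V E u. gwalks V E k (g p) (g v))"
    using sum.reindex_bij_betw[OF graph_aut_nbhd[OF g Suc.prems], of "\<lambda>q. gwalks V E k q (g v)"]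
    by simp
  also have "\<dots> = (\<Sum>p\<in>nbhd V E u. gwalks V E k p v)"
    using Suc.IH nbhd_subset by (intro sum.cong) fastforce+
  finally show ?case by simp
qed

lemma gwalks_last:
  assumes "finite V" "u \<in> V" "v \<in> V"
  shows "gwalks V E (Suc k) u v = (\<Sum>p\<in>nbhd V E v. gwalks V E k u p)"
  using assms(2)
proof (induction k arbitrary: u)
  case 0
  have fin: "finite (nbhd V E w)" for w
    using assms(1) nbhd_subset finite_subset by metis
  have "gwalks V E (Suc 0) u v = of_bool (v \<in> nbhd V E u)"
    using fin by (simp add: sum.delta of_bool_def)
  also have "\<dots> = of_bool (u \<in> nbhd V E v)"
    using nbhd_sym[of u V v E] nbhd_sym[of v V u E] 0 assms by auto
  also have "\<dots> = (\<Sum>p\<in>nbhd V E v. gwalks V E 0 u p)"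
    using fin by (simp add: sum.delta of_bool_def eq_commute)
  finally show ?case .
next
  case (Suc k)
  have "gwalks V E (Suc (Suc k)) u v = (\<Sum>q\<in>nbhd V E u. gwalks V E (Suc k) q v)"
    by (rule gwalks.simps)
  also have "\<dots> = (\<Sum>q\<in>nbhd V E u. \<Sum>p\<in>nbhd V E v. gwalks V E k q p)"
    using Suc.IH nbhd_subset[of V E u] by (intro sum.cong) (blast+)
  also have "\<dots> = (\<Sum>p\<in>nbhd V E v. \<Sum>q\<in>nbhd V E u. gwalks V E k q p)"
    by (rule sum.swap)
  finally show ?case by simp
qed

lemma gwalks_sym:
  assumes "finite V" "u \<in> V" "v \<in> V"
  shows "gwalks V E k u v = gwalks V E k v u"
  using assms(2,3)
proof (induction k arbitrary: u v)
  case (Suc k)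
  have "gwalks V E (Suc k) u v = (\<Sum>p\<in>nbhd V E v. gwalks V E k u p)"
    using gwalks_last assms(1) Suc.prems by metis
  also have "\<dots> = (\<Sum>p\<in>nbhd V E v. gwalks V E k p u)"
    using Suc nbhd_subset[of V E v] by (intro sum.cong) blast+
  finally show ?case by simp
qed auto

lemma invariant_weight_gwalks: "finite V \<Longrightarrow> invariant_weight V E (gwalks V E k)"
  by (auto simp: invariant_weight_def gwalks_graph_aut gwalks_sym)

text \<open>The sum of the weights at a neighbour of \<open>v\<close> does not depend on the neighbour; four such
  sums, one for each neighbour, determine the differences of weights of complementary pairs.\<close>

lemma complementary_weights:
  assumes arc: "arc_transitive V E" and f: "invariant_weight V E f" and v: "v \<in> V"
    and nb: "nbhd V E v = {x, y, z, w}" and dist: "distinct [x, y, z, w]"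
  shows "f x y = f z w"
proof -
  have const: "(\<Sum>q\<in>nbhd V E v - {p}. f p q) = (\<Sum>q\<in>nbhd V E v - {p'}. f p' q)"
    if p: "p \<in> nbhd V E v" "p' \<in> nbhd V E v" for p p'
  proof -
    obtain g where g: "g \<in> graph_auts V E" "g v = v" "g p = p'"
      using arc p v unfolding arc_transitive_def by blast
    have "bij_betw g (nbhd V E v) (nbhd V E v)"
      using graph_aut_nbhd[OF g(1) v] g(2) by simp
    then have bij: "bij_betw g (nbhd V E v - {p}) (nbhd V E v - {p'})"
      using p g(3) by (metis bij_betw_DiffI bij_betw_singletonI empty_subsetI insert_subset)
    have "(\<Sum>q\<in>nbhd V E v - {p'}. f p' q) = (\<Sum>q\<in>nbhd V E v - {p}. f (g p) (g q))"
      using sum.reindex_bij_betw[OF bij, of "f p'"] g(3) by simp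
    also have "\<dots> = (\<Sum>q\<in>nbhd V E v - {p}. f p q)"
      using f g(1) p nbhd_subset[of V E v] by (intro sum.cong) (auto simp: invariant_weight_def)
    finally show ?thesis by simp
  qed
  have sub: "{x, y, z, w} \<subseteq> V" using nb nbhd_subset by metis
  then have sym: "f y x = f x y" "f z x = f x z" "f w x = f x w" "f z y = f y z" "f w y = f y w" "f w z = f z w"
    using f by (auto simp: invariant_weight_def)
  have "nbhd V E v - {x} = {y, z, w}" "nbhd V E v - {y} = {x, z, w}"
    "nbhd V E v - {z} = {x, y, w}" "nbhd V E v - {w} = {x, y, z}"
    using dist nb by auto
  \<comment> \<open>Adding the last two equations and subtracting the first leaves
    \<open>2 * f x y = 2 * f z w\<close>.\<close>
  then have "f x y + (f x z + f x w) = f x y + (f y z + f y w)"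
    "f x y + (f x z + f x w) = f x z + (f y z + f z w)"
    "f x y + (f x z + f x w) = f x w + (f y w + f z w)"
    using const[of x y] const[of x z] const[of x w] dist nb sym by auto
  then show ?thesis by linarith
qed

text \<open>An automorphism taking \<open>v\<close> to \<open>v'\<close> carries pairs of neighbours
  to pairs of neighbours. This is what links the weights at an \<open>A\<close>-vertex to those at a
  \<open>B\<close>-vertex.\<close>

lemma pair_weight_transfer:
  assumes arc: "arc_transitive V E" and f: "invariant_weight V E f" and v: "v \<in> V" "v' \<in> V"
    and x: "x \<in> nbhd V E v" "y \<in> nbhd V E v" "x \<noteq> y" and ne: "nbhd V E v' \<noteq> {}"
  shows "\<exists>x'\<in>nbhd V E v'. \<exists>y'\<in>nbhd V E v'. x' \<noteq> y' \<and> f x y = f x' y'"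
proof -
  obtain g where g: "g \<in> graph_auts V E" "g v = v'"
    using arc v x(1) ne unfolding arc_transitive_def by blast
  have xV: "x \<in> V" "y \<in> V" using x nbhd_subset[of V E v] by auto
  have "g x \<in> nbhd V E v'" "g y \<in> nbhd V E v'"
    using graph_aut_nbhd[OF g(1) v(1)] x g(2) by (auto simp: bij_betw_def)
  moreover have "g x \<noteq> g y" using graph_autsD(4)[OF g(1)] x(3) xV by (auto simp: inj_on_def)
  moreover have "f x y = f (g x) (g y)" using f g(1) xV by (simp add: invariant_weight_def)
  ultimately show ?thesis by blast
qed

text \<open>An automorphism that takes the edge \<open>{u, v}\<close> to another edge with the wrong
  orientation is corrected by composing it with the reversal \<open>\<phi>\<close>.\<close>

lemma edge_transitive_arc:
  assumes et: "edge_transitive V E" and sg: "simple_graph V E"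
    and e: "u \<in> V" "v \<in> V" "{u, v} \<in> E"
    and \<phi>: "\<phi> \<in> graph_auts V E" "\<phi> u = v" "\<phi> v = u"
  shows "arc_transitive V E"
proof -
  interpret G: group "AutGraph V E" by (rule group_AutGraph)
  have car: "carrier (AutGraph V E) = graph_auts V E" by (simp add: AutGraph_def)
  have mult: "g \<otimes>\<^bsub>AutGraph V E\<^esub> h = compose V g h" if "g \<in> graph_auts V E" "h \<in> graph_auts V E" for g h
    using that by (simp add: AutGraph_def BijGroup_def graph_auts_def)
  have comp: "compose V g h \<in> graph_auts V E" if "g \<in> graph_auts V E" "h \<in> graph_auts V E" for g h
    using G.m_closed[of g h] mult[OF that] that by (simp add: car)
  have step: "\<exists>g\<in>graph_auts V E. g u = p \<and> g v = q" if pq: "p \<in> V" "q \<in> nbhd V E p" for p q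
  proof -
    have E: "{p, q} \<in> E" using pq by (simp add: nbhd_def)
    then obtain g where g: "g \<in> graph_auts V E" "g ` {u, v} = {p, q}"
      using et e(3) unfolding edge_transitive_def car by blast
    then consider "g u = p" "g v = q" | "g u = q" "g v = p"
      by (auto simp: doubleton_eq_iff)
    then show ?thesis
    proof cases
      case 1
      then show ?thesis using g by blast
    next
      case 2
      then have "compose V g \<phi> u = p" "compose V g \<phi> v = q"
        using \<phi> e by (auto simp: compose_eq)
      then show ?thesis using comp[OF g(1) \<phi>(1)] by blast
    qed
  qed
  show ?thesis
    unfolding arc_transitive_def
  proof (intro ballI)
    fix p q p' q' assume pq: "p \<in> V" "q \<in> nbhd V E p" "p' \<in> V" "q' \<in> nbhd V E p'"
    obtain g g' where g: "g \<in> graph_auts V E" "g u = p" "g v = q"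
      and g': "g' \<in> graph_auts V E" "g' u = p'" "g' v = q'"
      using step pq by metis
    \<comment> \<open>Every arc is an image of \<open>(u, v)\<close>, so any arc is carried back to
      \<open>(u, v)\<close> and from there to the desired arc.\<close>
    define h where "h = inv\<^bsub>AutGraph V E\<^esub> g"
    have h: "h \<in> graph_auts V E" using G.inv_closed[of g] g(1) by (simp add: h_def car)
    have "compose V h g = \<one>\<^bsub>AutGraph V E\<^esub>"
      using G.l_inv[of g] mult[OF h g(1)] g(1) by (simp add: h_def car)
    then have "compose V h g = (\<lambda>x\<in>V. x)" by (simp add: AutGraph_def BijGroup_def)
    then have "h p = u" "h q = v" using g e by (metis compose_eq restrict_apply')+
    moreover have "p \<in> V" "q \<in> V" using pq by (auto simp: nbhd_def)
    ultimately have "compose V g' h p = p'" "compose V g' h q = q'"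
      using g' by (auto simp: compose_eq)
    then show "\<exists>k\<in>graph_auts V E. k p = p' \<and> k q = q'" using comp[OF g'(1) h] by blast
  qed
qed

section \<open>Walks in the Woolly Hat graph\<close>

fun red :: "int \<Rightarrow> wh_vertex \<Rightarrow> wh_vertex" where
  "red n (A i) = A (i mod n)"
| "red n (B i) = B (i mod n)"
| "red n (C i) = C (i mod n)"

text \<open>Walks on the integer lifts of the vertices: the indices are not reduced until the walk ends.\<close>

fun walks :: "int \<Rightarrow> int \<Rightarrow> int \<Rightarrow> int \<Rightarrow> int \<Rightarrow> nat \<Rightarrow> wh_vertex \<Rightarrow> wh_vertex \<Rightarrow> nat" where
  "walks n a b c d 0 u v = of_bool (red n u = red n v)"
| "walks n a b c d (Suc k) (A i) v =
     walks n a b c d k (A (i - a)) v + walks n a b c d k (A (i + a)) v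
     + walks n a b c d k (B i) v + walks n a b c d k (C i) v"
| "walks n a b c d (Suc k) (B i) v =
     walks n a b c d k (A i) v + walks n a b c d k (C (i + b)) v
     + walks n a b c d k (C (i + c)) v + walks n a b c d k (C (i + d)) v"
| "walks n a b c d (Suc k) (C i) v =
     walks n a b c d k (A i) v + walks n a b c d k (B (i - b)) v
     + walks n a b c d k (B (i - c)) v + walks n a b c d k (B (i - d)) v"

lemma red_eq_iff [simp]:
  "red n (A i) = red n (A j) \<longleftrightarrow> n dvd i - j"
  "red n (B i) = red n (B j) \<longleftrightarrow> n dvd i - j"
  "red n (C i) = red n (C j) \<longleftrightarrow> n dvd i - j"
  "red n (A i) \<noteq> red n (B j)" "red n (B i) \<noteq> red n (A j)"
  "red n (A i) \<noteq> red n (C j)" "red n (C i) \<noteq> red n (A j)"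
  "red n (B i) \<noteq> red n (C j)" "red n (C i) \<noteq> red n (B j)"
  by (auto simp: mod_eq_dvd_iff)

text \<open>The assumption to be refuted. It survives a change of representatives, permutations of
  \<open>b\<close>, \<open>c\<close>, \<open>d\<close> and negation of \<open>a\<close>, so that the
  parameters can be normalised freely.\<close>

definition WH_edge_trans :: "int \<Rightarrow> int \<Rightarrow> int \<Rightarrow> int \<Rightarrow> int \<Rightarrow> bool" where
  "WH_edge_trans n a b c d \<longleftrightarrow>
     n > 0 \<and> \<not> n dvd 2 * a \<and> \<not> n dvd b - c \<and> \<not> n dvd b - d \<and> \<not> n dvd c - d \<and>
     simple_graph (WH_verts n) (WH_edges n a b c d) \<and>
     edge_transitive (WH_verts n) (WH_edges n a b c d)"

lemma dvd_cong_diff: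
  fixes n x y :: int
  assumes "n dvd x - y"
  shows "n dvd x \<longleftrightarrow> n dvd y"
  using dvd_add_right_iff[OF assms, of y] by simp

lemma WH_nbrs_cong:
  assumes "n dvd a - a'" "n dvd b - b'" "n dvd c - c'" "n dvd d - d'"
  shows "WH_nbrs n a b c d u = WH_nbrs n a' b' c' d' u"
proof -
  have *: "(i - x) mod n = (i - x') mod n" "(i + x) mod n = (i + x') mod n" if "n dvd x - x'" for x x' i
    using that by (simp_all add: mod_eq_dvd_iff dvd_diff_commute)
  show ?thesis using *[OF assms(1)] *[OF assms(2)] *[OF assms(3)] *[OF assms(4)] by (cases u) simp_all
qed

lemma WH_edge_trans_cong:
  assumes "WH_edge_trans n a b c d"
    and "n dvd a - a'" "n dvd b - b'" "n dvd c - c'" "n dvd d - d'"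
  shows "WH_edge_trans n a' b' c' d'"
proof -
  have E: "WH_edges n a b c d = WH_edges n a' b' c' d'"
    unfolding WH_edges_def using WH_nbrs_cong[OF assms(2-5)] by simp
  have *: "n dvd x - y \<longleftrightarrow> n dvd x' - y'" if "n dvd x - x'" "n dvd y - y'" for x y x' y'
  proof (rule dvd_cong_diff)
    show "n dvd x - y - (x' - y')" using dvd_diff[OF that] by (simp add: algebra_simps)
  qed
  have a: "n dvd 2 * a \<longleftrightarrow> n dvd 2 * a'"
  proof (rule dvd_cong_diff)
    show "n dvd 2 * a - 2 * a'" using dvd_mult[OF assms(2), of 2] by (simp add: algebra_simps)
  qed
  show ?thesis
    using assms(1) unfolding WH_edge_trans_def E a *[OF assms(3,4)] *[OF assms(3,5)] *[OF assms(4,5)] .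
qed

lemma WH_edge_trans_swap:
  assumes "WH_edge_trans n a b c d"
  shows "WH_edge_trans n a c b d" "WH_edge_trans n a b d c" "WH_edge_trans n (- a) b c d"
proof -
  have "WH_nbrs n a c b d u = WH_nbrs n a b c d u" "WH_nbrs n a b d c u = WH_nbrs n a b c d u"
    "WH_nbrs n (- a) b c d u = WH_nbrs n a b c d u" for u
    by (cases u; auto)+
  then have "WH_edges n a c b d = WH_edges n a b c d" "WH_edges n a b d c = WH_edges n a b c d"
    "WH_edges n (- a) b c d = WH_edges n a b c d"
    unfolding WH_edges_def by simp_all
  then show "WH_edge_trans n a c b d" "WH_edge_trans n a b d c" "WH_edge_trans n (- a) b c d"
    using assms by (auto simp: WH_edge_trans_def dvd_diff_commute)
qed

context
  fixes n a b c d :: int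
  assumes H: "WH_edge_trans n a b c d"
begin

private abbreviation (input) "V \<equiv> WH_verts n"
private abbreviation (input) "E \<equiv> WH_edges n a b c d"

private lemma n_pos: "n > 0" and basic: "\<not> n dvd 2 * a" "\<not> n dvd b - c" "\<not> n dvd b - d" "\<not> n dvd c - d"
  and sg: "simple_graph V E" and et: "edge_transitive V E"
  using H by (auto simp: WH_edge_trans_def)

private lemma finite_V: "finite V"
  by (simp add: WH_verts_def)

private lemma red_in [simp]: "red n u \<in> V"
  using n_pos by (cases u) (auto simp: WH_verts_def)

private lemma red_V: "u \<in> V \<Longrightarrow> red n u = u"
  by (auto simp: WH_verts_def)

private lemma nbrs_in: "u \<in> V \<Longrightarrow> p \<in> WH_nbrs n a b c d u \<Longrightarrow> p \<in> V"
  using n_pos by (cases u) (auto simp: WH_verts_def)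

lemma WH_edge_iff:
  assumes "u \<in> V" "p \<in> V"
  shows "{u, p} \<in> E \<longleftrightarrow> p \<in> WH_nbrs n a b c d u"
  using assms WH_nbrs_sym[OF assms, of a b c d] unfolding WH_edges_def
  by (auto simp: doubleton_eq_iff)

lemma nbhd_red:
  "nbhd V E (red n (A i)) = {red n (A (i - a)), red n (A (i + a)), red n (B i), red n (C i)}"
  "nbhd V E (red n (B i)) = {red n (A i), red n (C (i + b)), red n (C (i + c)), red n (C (i + d))}"
  "nbhd V E (red n (C i)) = {red n (A i), red n (B (i - b)), red n (B (i - c)), red n (B (i - d))}"
proof -
  have *: "nbhd V E (red n u) = WH_nbrs n a b c d (red n u)" for u
    using nbrs_in[OF red_in] by (auto simp: nbhd_def WH_edge_iff)
  show "nbhd V E (red n (A i)) = {red n (A (i - a)), red n (A (i + a)), red n (B i), red n (C i)}"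
    "nbhd V E (red n (B i)) = {red n (A i), red n (C (i + b)), red n (C (i + c)), red n (C (i + d))}"
    "nbhd V E (red n (C i)) = {red n (A i), red n (B (i - b)), red n (B (i - c)), red n (B (i - d))}"
    unfolding * by (simp_all add: mod_simps)
qed

private lemma distinct_nbhd:
  "distinct [red n (A (i - a)), red n (A (i + a)), red n (B i), red n (C i)]"
  "distinct [red n (A i), red n (C (i + b)), red n (C (i + c)), red n (C (i + d))]"
  "distinct [red n (A i), red n (B (i - b)), red n (B (i - c)), red n (B (i - d))]"
  using basic by (auto simp del: red.simps simp: dvd_diff_commute)

text \<open>The recursion for \<open>walks\<close> adds four terms, that for \<open>gwalks\<close>
  sums over a set; they agree because the four neighbours of a vertex are distinct.\<close>

lemma gwalks_red: "gwalks V E k (red n u) (red n v) = walks n a b c d k u v"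
proof (induction k arbitrary: u)
  case (Suc k)
  show ?case
  proof (cases u)
    case (A i)
    then show ?thesis using Suc distinct_nbhd(1)[of i] by (simp del: red.simps add: nbhd_red)
  next
    case (B i)
    then show ?thesis using Suc distinct_nbhd(2)[of i] by (simp del: red.simps add: nbhd_red)
  next
    case (C i)
    then show ?thesis using Suc distinct_nbhd(3)[of i] by (simp del: red.simps add: nbhd_red)
  qed
qed (simp del: red.simps)

text \<open>The reflection \<open>A i \<mapsto> A (b - i)\<close>, \<open>B i \<mapsto> C (b - i)\<close>, \<open>C i \<mapsto> B (b - i)\<close> reverses the edge
  \<open>{B 0, C b}\<close>.\<close>

lemma arc_transitive_WH: "arc_transitive V E"
proof -
  define \<psi> where "\<psi> u = (case u of A i \<Rightarrow> A (b - i) | B i \<Rightarrow> C (b - i) | C i \<Rightarrow> B (b - i))" for u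
  define \<phi> where "\<phi> = (\<lambda>u\<in>V. red n (\<psi> u))"
  have \<psi>_simps: "\<psi> (A i) = A (b - i)" "\<psi> (B i) = C (b - i)" "\<psi> (C i) = B (b - i)" for i
    by (simp_all add: \<psi>_def)
  have \<phi>_red: "\<phi> (red n u) = red n (\<psi> u)" for u
  proof -
    have "red n (\<psi> (red n u)) = red n (\<psi> u)"
      by (cases u) (simp_all add: \<psi>_simps mod_simps)
    then show ?thesis by (simp add: \<phi>_def)
  qed
  have inv: "\<phi> (\<phi> u) = u" if "u \<in> V" for u
  proof -
    have "\<phi> (\<phi> (red n u)) = red n u"
      unfolding \<phi>_red by (cases u) (simp_all add: \<psi>_simps)
    then show ?thesis using red_V[OF that] by simp
  qed
  have \<phi>V: "\<phi> u \<in> V" if "u \<in> V" for u using that by (simp add: \<phi>_def)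
  have "bij_betw \<phi> V V" using inv \<phi>V by (intro bij_betw_byWitness[of V \<phi> \<phi>]) auto
  then have Bij: "\<phi> \<in> Bij V" by (simp add: Bij_def \<phi>_def)
  have pres: "\<phi> p \<in> nbhd V E (\<phi> u)" if "u \<in> V" "p \<in> nbhd V E u" for u p
  proof -
    have "\<forall>p\<in>nbhd V E (red n u). \<phi> p \<in> nbhd V E (\<phi> (red n u))"
      by (cases u) (auto simp del: red.simps simp: nbhd_red \<phi>_red \<psi>_simps algebra_simps)
    then show ?thesis using that red_V by metis
  qed
  have "{\<phi> u, \<phi> v} \<in> E \<longleftrightarrow> {u, v} \<in> E" if "u \<in> V" "v \<in> V" for u v
    using pres[of u v] pres[of "\<phi> u" "\<phi> v"] inv \<phi>V that by (auto simp: nbhd_def)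
  then have aut: "\<phi> \<in> graph_auts V E" using Bij by (simp add: graph_auts_def)
  have "red n (C b) \<in> nbhd V E (red n (B 0))" by (simp del: red.simps add: nbhd_red)
  then have "{red n (B 0), red n (C b)} \<in> E" by (simp add: nbhd_def)
  moreover have "\<phi> (red n (B 0)) = red n (C b)" "\<phi> (red n (C b)) = red n (B 0)"
    unfolding \<phi>_red \<psi>_simps by simp_all
  ultimately show ?thesis
    using edge_transitive_arc[OF et sg _ _ _ aut] red_in by metis
qed

text \<open>The neighbours of \<open>A 0\<close> split into the complementary pairs
  \<open>A (- a)\<close>, \<open>A a\<close> and \<open>B 0\<close>, \<open>C 0\<close>. The six
  pairs of neighbours of \<open>B 0\<close> form three complementary couples, so only three weights
  occur there, and transferring a pair from \<open>A 0\<close> to \<open>B 0\<close> gives the last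
  claim.\<close>

lemma local_weights:
  assumes f: "invariant_weight V E f"
  defines "F \<equiv> \<lambda>u v. f (red n u) (red n v)"
  shows "F (A (- a)) (A a) = F (B 0) (C 0)"
    "F (A 0) (C b) = F (C c) (C d)" "F (A 0) (C c) = F (C b) (C d)" "F (A 0) (C d) = F (C b) (C c)"
    "F (A (- a)) (A a) \<in> {F (A 0) (C b), F (A 0) (C c), F (A 0) (C d)}"
proof -
  note arc = arc_transitive_WH
  define x where "x = red n (A (- a))"
  define x' where "x' = red n (A a)"
  define y where "y = red n (B 0)"
  define z where "z = red n (C 0)"
  define w where "w = red n (A 0)"
  define p where "p = red n (C b)"
  define q where "q = red n (C c)"
  define r where "r = red n (C d)"
  note defs = x_def x'_def y_def z_def w_def p_def q_def r_def
  have nA: "nbhd V E w = {x, x', y, z}" and dA: "distinct [x, x', y, z]"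
    using nbhd_red(1)[of 0] distinct_nbhd(1)[of 0] by (simp_all add: defs del: red.simps)
  have nB: "nbhd V E y = {w, p, q, r}" and dB: "distinct [w, p, q, r]"
    using nbhd_red(2)[of 0] distinct_nbhd(2)[of 0] by (simp_all add: defs del: red.simps)
  have V: "x \<in> V" "x' \<in> V" "y \<in> V" "z \<in> V" "w \<in> V" "p \<in> V" "q \<in> V" "r \<in> V"
    by (simp_all add: defs del: red.simps)
  note cw = complementary_weights[OF arc f]
  have A1: "f x x' = f y z" using cw[OF V(5) nA dA] .
  have B1: "f w p = f q r" "f w q = f p r" "f w r = f p q"
    using cw[OF V(3), of w p q r] cw[OF V(3), of w q p r] cw[OF V(3), of w r p q] nB dB
    by (auto simp: insert_commute)
  have sym: "f s t = f t s" if "s \<in> V" "t \<in> V" for s t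
    using f that by (simp add: invariant_weight_def)
  have vB: "f s t \<in> {f w p, f w q, f w r}" if "s \<in> nbhd V E y" "t \<in> nbhd V E y" "s \<noteq> t" for s t
    using that B1 sym V unfolding nB by auto
  have "x \<in> nbhd V E w" "x' \<in> nbhd V E w" "x \<noteq> x'" using nA dA by auto
  then obtain s t where "s \<in> nbhd V E y" "t \<in> nbhd V E y" "s \<noteq> t" "f x x' = f s t"
    using pair_weight_transfer[OF arc f V(5) V(3)] nB by blast
  then have "f x x' \<in> {f w p, f w q, f w r}" using vB by metis
  then show "F (A (- a)) (A a) = F (B 0) (C 0)"
    "F (A 0) (C b) = F (C c) (C d)" "F (A 0) (C c) = F (C b) (C d)" "F (A 0) (C d) = F (C b) (C c)"
    "F (A (- a)) (A a) \<in> {F (A 0) (C b), F (A 0) (C c), F (A 0) (C d)}"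
    using A1 B1 by (simp_all only: F_def defs)
qed

lemma local_walks:
  defines "w \<equiv> walks n a b c d"
  shows "w k (A (- a)) (A a) = w k (B 0) (C 0)"
    "w k (A 0) (C b) = w k (C c) (C d)" "w k (A 0) (C c) = w k (C b) (C d)" "w k (A 0) (C d) = w k (C b) (C c)"
    "w k (A (- a)) (A a) \<in> {w k (A 0) (C b), w k (A 0) (C c), w k (A 0) (C d)}"
  unfolding w_def using local_weights[OF invariant_weight_gwalks[OF finite_V]]
  by (simp_all only: gwalks_red)

lemma edge_walks:
  assumes "red n v \<in> nbhd V E (red n u)" "red n v' \<in> nbhd V E (red n u')"
  shows "walks n a b c d k u v = walks n a b c d k u' v'"
proof -
  obtain g where g: "g \<in> graph_auts V E" "g (red n u) = red n u'" "g (red n v) = red n v'"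
    using arc_transitive_WH assms red_in unfolding arc_transitive_def by blast
  show ?thesis using gwalks_graph_aut[OF g(1) red_in red_in, of k u v] by (simp add: g(2,3) gwalks_red)
qed

text \<open>Every edge lies in the same number of triangles, counted by walks of length two between
  its ends. The edge from \<open>B 0\<close> to \<open>C s\<close> lies in a triangle only if
  \<open>s\<close> is zero modulo \<open>n\<close>, which cannot hold for all of the distinct
  \<open>b\<close>, \<open>c\<close>, \<open>d\<close>. Hence there are none, and
  \<open>3 * a = 0\<close> would give one on \<open>A\<close>-vertices.\<close>

lemma no_triangles: "\<not> n dvd b" "\<not> n dvd c" "\<not> n dvd d" "\<not> n dvd 3 * a"
proof -
  have na: "\<not> n dvd a" using basic(1) by (metis dvd_mult)
  let ?w = "walks n a b c d (Suc (Suc 0))"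
  have w: "?w (B 0) (C s) = of_bool (n dvd s)" for s
    by (simp del: red.simps)
  have "?w (B 0) (C b) = ?w (B 0) (C c)" "?w (B 0) (C b) = ?w (B 0) (C d)"
    by (rule edge_walks; simp del: red.simps add: nbhd_red)+
  then have "(n dvd b) = (n dvd c)" "(n dvd b) = (n dvd d)" by (simp_all only: w of_bool_eq_iff)
  then show nb: "\<not> n dvd b" "\<not> n dvd c" "\<not> n dvd d"
    using basic(2) dvd_diff by blast+
  have "?w (A 0) (A a) = ?w (B 0) (C b)"
    by (rule edge_walks; simp del: red.simps add: nbhd_red)
  then have "?w (A 0) (A a) = 0" using nb(1) unfolding w by simp
  then show "\<not> n dvd 3 * a" using na by (simp del: red.simps)
qed

end

declare walks.simps [simp del]

section \<open>Integer combinations of the parameters\<close>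

text \<open>Vertex indices are written as combinations of at most four parameters with numeral
  coefficients, so that the simplifier can expand the number of walks between two vertices into a
  sum of truth values of divisibility conditions \<open>dv n g i j k l\<close>.\<close>

definition lc :: "int \<times> int \<times> int \<times> int \<Rightarrow> int \<Rightarrow> int \<Rightarrow> int \<Rightarrow> int \<Rightarrow> int" where
  "lc g i j k l = (case g of (p, q, r, s) \<Rightarrow> i * p + j * q + k * r + l * s)"

definition dv :: "int \<Rightarrow> int \<times> int \<times> int \<times> int \<Rightarrow> int \<Rightarrow> int \<Rightarrow> int \<Rightarrow> int \<Rightarrow> bool" where
  "dv n g i j k l \<longleftrightarrow> n dvd lc g i j k l"

lemma dv_lincomb:
  assumes "dv n g i j k l" "dv n g i' j' k' l'"
    and "x = s * i + t * i'" "y = s * j + t * j'" "z = s * k + t * k'" "w = s * l + t * l'"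
  shows "dv n g x y z w"
proof -
  have "lc g x y z w = s * lc g i j k l + t * lc g i' j' k' l'"
    using assms(3-6) by (simp add: lc_def algebra_simps split: prod.splits)
  then show ?thesis using assms(1,2) by (simp add: dv_def)
qed

lemma dv_0 [simp]: "dv n g 0 0 0 0"
  by (simp add: dv_def lc_def split: prod.splits)

lemma dv_neg: "dv n g (- i) (- j) (- k) (- l) = dv n g i j k l"
proof -
  have "lc g (- i) (- j) (- k) (- l) = - lc g i j k l" by (simp add: lc_def split: prod.splits)
  then show ?thesis by (simp add: dv_def)
qed

text \<open>Makes the first nonzero coefficient positive, so that a relation and its negative become
  the same term for the simplifier.\<close>

lemma dv_sign:
  "dv n g (- numeral u) j k l = dv n g (numeral u) (- j) (- k) (- l)"
  "dv n g (- 1) j k l = dv n g 1 (- j) (- k) (- l)"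
  "dv n g 0 (- numeral u) k l = dv n g 0 (numeral u) (- k) (- l)"
  "dv n g 0 (- 1) k l = dv n g 0 1 (- k) (- l)"
  "dv n g 0 0 (- numeral u) l = dv n g 0 0 (numeral u) (- l)"
  "dv n g 0 0 (- 1) l = dv n g 0 0 1 (- l)"
  "dv n g 0 0 0 (- numeral u) = dv n g 0 0 0 (numeral u)"
  "dv n g 0 0 0 (- 1) = dv n g 0 0 0 1"
  using dv_neg[of n g] by (metis add.inverse_inverse minus_zero)+

text \<open>For a third parameter of order dividing two. The side conditions on \<open>k\<close>
  keep the rewriting from looping on coefficients that are already reduced.\<close>

lemma dv_mod2:
  assumes "dv n g 0 0 2 0"
  shows "k \<noteq> 0 \<Longrightarrow> k \<noteq> 1 \<Longrightarrow> dv n g i j k l = dv n g i j (k mod 2) l"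
proof -
  have k: "2 * (k div 2) + k mod 2 = k" by simp
  have "dv n g i j k l" if "dv n g i j (k mod 2) l"
    by (rule dv_lincomb[OF that assms, of _ 1 "k div 2"]) (use k in auto)
  moreover have "dv n g i j (k mod 2) l" if "dv n g i j k l"
    by (rule dv_lincomb[OF that assms, of _ 1 "- (k div 2)"]) (use k in linarith)+
  ultimately show ?thesis by blast
qed

lemma of_bool_add_ge_2: "2 \<le> of_bool P + (of_bool Q :: nat) \<longleftrightarrow> P \<and> Q"
  by auto

text \<open>A copy of addition that the arithmetic simplification procedures ignore while walks are
  being expanded.\<close>

definition nadd :: "nat \<Rightarrow> nat \<Rightarrow> nat" where
  "nadd x y = x + y"

lemma nadd_0 [simp]: "nadd 0 x = x" "nadd x 0 = x"
  by (simp_all add: nadd_def)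

lemma lc_add: "lc g i j k l + lc g i' j' k' l' = lc g (i + i') (j + j') (k + k') (l + l')"
  by (simp add: lc_def algebra_simps split: prod.splits)

lemma lc_diff: "lc g i j k l - lc g i' j' k' l' = lc g (i - i') (j - j') (k - k') (l - l')"
  by (simp add: lc_def algebra_simps split: prod.splits)

context
  fixes n a b c d :: int and g and b1 b2 b3 b4 c1 c2 c3 c4 d1 d2 d3 d4 :: int
  assumes a: "a = lc g 1 0 0 0" and b: "b = lc g b1 b2 b3 b4"
    and c: "c = lc g c1 c2 c3 c4" and d: "d = lc g d1 d2 d3 d4"
begin

lemma walks_lc:
  "walks n a b c d (Suc m) (A (lc g i j k l)) v =
     nadd (nadd (walks n a b c d m (A (lc g (i - 1) j k l)) v) (walks n a b c d m (A (lc g (i + 1) j k l)) v))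
       (nadd (walks n a b c d m (B (lc g i j k l)) v) (walks n a b c d m (C (lc g i j k l)) v))"
  "walks n a b c d (Suc m) (B (lc g i j k l)) v =
     nadd (nadd (walks n a b c d m (A (lc g i j k l)) v)
       (walks n a b c d m (C (lc g (i + b1) (j + b2) (k + b3) (l + b4))) v))
     (nadd (walks n a b c d m (C (lc g (i + c1) (j + c2) (k + c3) (l + c4))) v)
       (walks n a b c d m (C (lc g (i + d1) (j + d2) (k + d3) (l + d4))) v))"
  "walks n a b c d (Suc m) (C (lc g i j k l)) v =
     nadd (nadd (walks n a b c d m (A (lc g i j k l)) v)
       (walks n a b c d m (B (lc g (i - b1) (j - b2) (k - b3) (l - b4))) v))
     (nadd (walks n a b c d m (B (lc g (i - c1) (j - c2) (k - c3) (l - c4))) v)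
       (walks n a b c d m (B (lc g (i - d1) (j - d2) (k - d3) (l - d4))) v))"
  unfolding a b c d by (simp_all add: walks.simps lc_add lc_diff nadd_def)

lemma walks_0_lc:
  "walks n a b c d 0 (A (lc g i j k l)) (A (lc g i' j' k' l')) = of_bool (dv n g (i - i') (j - j') (k - k') (l - l'))"
  "walks n a b c d 0 (B (lc g i j k l)) (B (lc g i' j' k' l')) = of_bool (dv n g (i - i') (j - j') (k - k') (l - l'))"
  "walks n a b c d 0 (C (lc g i j k l)) (C (lc g i' j' k' l')) = of_bool (dv n g (i - i') (j - j') (k - k') (l - l'))"
  "walks n a b c d 0 (A i) (B j) = 0" "walks n a b c d 0 (B i) (A j) = 0"
  "walks n a b c d 0 (A i) (C j) = 0" "walks n a b c d 0 (C i) (A j) = 0"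
  "walks n a b c d 0 (B i) (C j) = 0" "walks n a b c d 0 (C i) (B j) = 0"
  unfolding walks.simps(1) red_eq_iff lc_diff dv_def by (simp_all del: red.simps)

lemma local_walks_lc:
  fixes k :: nat
  assumes "WH_edge_trans n a b c d"
  defines "w \<equiv> walks n a b c d k"
  defines "AA \<equiv> w (A (lc g (- 1) 0 0 0)) (A (lc g 1 0 0 0))"
    and "AC1 \<equiv> w (A (lc g 0 0 0 0)) (C (lc g b1 b2 b3 b4))"
    and "AC2 \<equiv> w (A (lc g 0 0 0 0)) (C (lc g c1 c2 c3 c4))"
    and "AC3 \<equiv> w (A (lc g 0 0 0 0)) (C (lc g d1 d2 d3 d4))"
  shows "AA = w (B (lc g 0 0 0 0)) (C (lc g 0 0 0 0))"
    "AC1 = w (C (lc g c1 c2 c3 c4)) (C (lc g d1 d2 d3 d4))"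
    "AC2 = w (C (lc g b1 b2 b3 b4)) (C (lc g d1 d2 d3 d4))"
    "AC3 = w (C (lc g b1 b2 b3 b4)) (C (lc g c1 c2 c3 c4))"
    "AA = AC1 \<or> AA = AC2 \<or> AA = AC3"
proof -
  have 0: "lc g 0 0 0 0 = 0" "lc g (- 1) 0 0 0 = - a"
    unfolding a by (simp_all add: lc_def split: prod.splits)
  note loc = local_walks[OF assms(1), of k]
  show "AA = w (B (lc g 0 0 0 0)) (C (lc g 0 0 0 0))"
    "AC1 = w (C (lc g c1 c2 c3 c4)) (C (lc g d1 d2 d3 d4))"
    "AC2 = w (C (lc g b1 b2 b3 b4)) (C (lc g d1 d2 d3 d4))"
    "AC3 = w (C (lc g b1 b2 b3 b4)) (C (lc g c1 c2 c3 c4))"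
    "AA = AC1 \<or> AA = AC2 \<or> AA = AC3"
    using loc unfolding assms(2-) 0 a[symmetric] b[symmetric] c[symmetric] d[symmetric]
    by (simp_all only: insert_iff empty_iff simp_thms)
qed

end

text \<open>Absence of cycles of length three and four. \<open>3 * a\<close> and \<open>x\<close>
  stand for triangles, \<open>4 * a\<close> for a cycle of \<open>A\<close>-vertices, and
  \<open>x + a\<close>, \<open>x - a\<close> for cycles with two \<open>A\<close>-vertices, one
  \<open>B\<close> and one \<open>C\<close>. The remaining differences are the closed walks of
  length four that alternate between \<open>B\<close> and \<open>C\<close> without
  backtracking.\<close>

definition no_short_cycles :: "int \<Rightarrow> int \<Rightarrow> int \<Rightarrow> int \<Rightarrow> int \<Rightarrow> bool" where
  "no_short_cycles n a b c d \<longleftrightarrow>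
     \<not> n dvd 2 * a \<and> \<not> n dvd 3 * a \<and> \<not> n dvd 4 * a \<and>
     (\<forall>x\<in>{b, c, d}. \<not> n dvd x \<and> \<not> n dvd x + a \<and> \<not> n dvd x - a) \<and>
     \<not> n dvd 2 * (b - c) \<and> \<not> n dvd 2 * (b - d) \<and> \<not> n dvd 2 * (c - d) \<and>
     \<not> n dvd 2 * b - c - d \<and> \<not> n dvd 2 * c - b - d \<and> \<not> n dvd 2 * d - b - c"

lemma no_short_cycles_lc:
  assumes N: "no_short_cycles n a b c d"
    and a: "a = lc g 1 0 0 0" and b: "b = lc g b1 b2 b3 b4"
    and c: "c = lc g c1 c2 c3 c4" and d: "d = lc g d1 d2 d3 d4"
  shows "\<not> dv n g 1 0 0 0" "\<not> dv n g 2 0 0 0" "\<not> dv n g 3 0 0 0" "\<not> dv n g 4 0 0 0"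
    "\<not> dv n g b1 b2 b3 b4" "\<not> dv n g c1 c2 c3 c4" "\<not> dv n g d1 d2 d3 d4"
    "\<not> dv n g (b1 + 1) b2 b3 b4" "\<not> dv n g (c1 + 1) c2 c3 c4" "\<not> dv n g (d1 + 1) d2 d3 d4"
    "\<not> dv n g (b1 - 1) b2 b3 b4" "\<not> dv n g (c1 - 1) c2 c3 c4" "\<not> dv n g (d1 - 1) d2 d3 d4"
    "\<not> dv n g (b1 - c1) (b2 - c2) (b3 - c3) (b4 - c4)"
    "\<not> dv n g (b1 - d1) (b2 - d2) (b3 - d3) (b4 - d4)"
    "\<not> dv n g (c1 - d1) (c2 - d2) (c3 - d3) (c4 - d4)"
    "\<not> dv n g (2 * (b1 - c1)) (2 * (b2 - c2)) (2 * (b3 - c3)) (2 * (b4 - c4))"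
    "\<not> dv n g (2 * (b1 - d1)) (2 * (b2 - d2)) (2 * (b3 - d3)) (2 * (b4 - d4))"
    "\<not> dv n g (2 * (c1 - d1)) (2 * (c2 - d2)) (2 * (c3 - d3)) (2 * (c4 - d4))"
    "\<not> dv n g (2 * b1 - c1 - d1) (2 * b2 - c2 - d2) (2 * b3 - c3 - d3) (2 * b4 - c4 - d4)"
    "\<not> dv n g (2 * c1 - b1 - d1) (2 * c2 - b2 - d2) (2 * c3 - b3 - d3) (2 * c4 - b4 - d4)"
    "\<not> dv n g (2 * d1 - b1 - c1) (2 * d2 - b2 - c2) (2 * d3 - b3 - c3) (2 * d4 - b4 - c4)"
proof -
  obtain p q r s where g: "g = (p, q, r, s)" by (cases g)
  note lcs = a[unfolded g lc_def] b[unfolded g lc_def] c[unfolded g lc_def] d[unfolded g lc_def]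
  have half: "\<not> n dvd x" if "\<not> n dvd 2 * x" for x using that by (metis dvd_mult)
  have *: "\<not> n dvd a" "\<not> n dvd b - c" "\<not> n dvd b - d" "\<not> n dvd c - d"
    using N half unfolding no_short_cycles_def by blast+
  show "\<not> dv n g 1 0 0 0" "\<not> dv n g 2 0 0 0" "\<not> dv n g 3 0 0 0" "\<not> dv n g 4 0 0 0"
    "\<not> dv n g b1 b2 b3 b4" "\<not> dv n g c1 c2 c3 c4" "\<not> dv n g d1 d2 d3 d4"
    "\<not> dv n g (b1 + 1) b2 b3 b4" "\<not> dv n g (c1 + 1) c2 c3 c4" "\<not> dv n g (d1 + 1) d2 d3 d4"
    "\<not> dv n g (b1 - 1) b2 b3 b4" "\<not> dv n g (c1 - 1) c2 c3 c4" "\<not> dv n g (d1 - 1) d2 d3 d4"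
    "\<not> dv n g (b1 - c1) (b2 - c2) (b3 - c3) (b4 - c4)"
    "\<not> dv n g (b1 - d1) (b2 - d2) (b3 - d3) (b4 - d4)"
    "\<not> dv n g (c1 - d1) (c2 - d2) (c3 - d3) (c4 - d4)"
    "\<not> dv n g (2 * (b1 - c1)) (2 * (b2 - c2)) (2 * (b3 - c3)) (2 * (b4 - c4))"
    "\<not> dv n g (2 * (b1 - d1)) (2 * (b2 - d2)) (2 * (b3 - d3)) (2 * (b4 - d4))"
    "\<not> dv n g (2 * (c1 - d1)) (2 * (c2 - d2)) (2 * (c3 - d3)) (2 * (c4 - d4))"
    "\<not> dv n g (2 * b1 - c1 - d1) (2 * b2 - c2 - d2) (2 * b3 - c3 - d3) (2 * b4 - c4 - d4)"
    "\<not> dv n g (2 * c1 - b1 - d1) (2 * c2 - b2 - d2) (2 * c3 - b3 - d3) (2 * c4 - b4 - d4)"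
    "\<not> dv n g (2 * d1 - b1 - c1) (2 * d2 - b2 - c2) (2 * d3 - b3 - c3) (2 * d4 - b4 - c4)"
    using N * unfolding no_short_cycles_def dv_def g lc_def lcs by (simp_all add: algebra_simps)
qed

section \<open>Cycles of length three and four\<close>

lemma of_bool_add_SucD: "of_bool P + (of_bool Q :: nat) = Suc m \<Longrightarrow> P \<or> Q"
  by (cases P; cases Q) auto

text \<open>A cyclic group has at most one element of order two.\<close>

lemma dvd_half:
  fixes n u v :: int
  assumes "n dvd 2 * u" "n dvd 2 * v" "\<not> n dvd u" "\<not> n dvd v"
  shows "n dvd u - v"
proof -
  obtain k l where k: "2 * u = n * k" and l: "2 * v = n * l" using assms(1,2) by (auto elim!: dvdE)
  have "odd k"
  proof
    assume "even k"
    then obtain m where "k = 2 * m" by (elim evenE)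
    then have "u = n * m" using k by simp
    then show False using assms(3) by simp
  qed
  moreover have "odd l"
  proof
    assume "even l"
    then obtain m where "l = 2 * m" by (elim evenE)
    then have "v = n * m" using l by simp
    then show False using assms(4) by simp
  qed
  ultimately have "even (k - l)" by simp
  then obtain m where "k - l = 2 * m" by (elim evenE)
  then have "2 * (u - v) = 2 * (n * m)" using k l by (simp add: algebra_simps)
  then have "u - v = n * m" by (metis mult_cancel_left zero_neq_numeral)
  then show ?thesis by simp
qed

lemma basic_lc:
  assumes H: "WH_edge_trans n a b c d"
    and a: "a = lc g 1 0 0 0" and b: "b = lc g b1 b2 b3 b4"
    and c: "c = lc g c1 c2 c3 c4" and d: "d = lc g d1 d2 d3 d4"
  shows "\<not> dv n g 1 0 0 0" "\<not> dv n g 2 0 0 0" "\<not> dv n g 3 0 0 0"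
    "\<not> dv n g b1 b2 b3 b4" "\<not> dv n g c1 c2 c3 c4" "\<not> dv n g d1 d2 d3 d4"
    "\<not> dv n g (b1 - c1) (b2 - c2) (b3 - c3) (b4 - c4)"
    "\<not> dv n g (b1 - d1) (b2 - d2) (b3 - d3) (b4 - d4)"
    "\<not> dv n g (c1 - d1) (c2 - d2) (c3 - d3) (c4 - d4)"
proof -
  obtain p q r s where g: "g = (p, q, r, s)" by (cases g)
  note lcs = a[unfolded g lc_def] b[unfolded g lc_def] c[unfolded g lc_def] d[unfolded g lc_def]
  have "\<not> n dvd a" using H unfolding WH_edge_trans_def by (metis dvd_mult)
  then show "\<not> dv n g 1 0 0 0" "\<not> dv n g 2 0 0 0" "\<not> dv n g 3 0 0 0"
    "\<not> dv n g b1 b2 b3 b4" "\<not> dv n g c1 c2 c3 c4" "\<not> dv n g d1 d2 d3 d4"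
    "\<not> dv n g (b1 - c1) (b2 - c2) (b3 - c3) (b4 - c4)"
    "\<not> dv n g (b1 - d1) (b2 - d2) (b3 - d3) (b4 - d4)"
    "\<not> dv n g (c1 - d1) (c2 - d2) (c3 - d3) (c4 - d4)"
    using H[unfolded WH_edge_trans_def] no_triangles[OF H]
    unfolding dv_def g lc_def lcs by (simp_all add: algebra_simps)
qed

text \<open>Walks of length two exclude \<open>4 * a = 0\<close> and \<open>3 * a = c\<close>; walks
  of length four then force \<open>6 * a = 0\<close>. But this makes \<open>3 * a\<close> and
  \<open>c\<close> both the element of order two.\<close>

lemma no_involution_pair_a:
  assumes H: "WH_edge_trans n a a c (- a)" and c: "n dvd 2 * c"
  shows False
proof -
  define g where "g = (a, 0::int, c, 0::int)"
  have lc: "a = lc g 1 0 0 0" "a = lc g 1 0 0 0" "c = lc g 0 0 1 0" "- a = lc g (- 1) 0 0 0"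
    by (simp_all add: g_def lc_def)
  have c': "dv n g 0 0 2 0" using c by (simp add: dv_def g_def lc_def)
  note [simp] = walks_lc[OF lc] walks_0_lc[OF lc] dv_sign dv_mod2[OF c']
  note basic [simp] = basic_lc[OF H lc, simplified]
  note E2 = local_walks_lc[OF lc H, of "Suc (Suc 0)", simplified, unfolded nadd_def, simplified]
  note [simp] = E2(1)
  note E = local_walks_lc(1)[OF lc H, of "Suc (Suc (Suc (Suc 0)))", simplified, unfolded nadd_def, simplified]
  note [simp] = E2(2)
  have "of_bool (dv n g 6 0 0 0) \<noteq> (0::nat)" using E by simp
  then have "dv n g 6 0 0 0" unfolding of_bool_eq_0_iff by blast
  then have "n dvd 2 * (3 * a)" by (simp add: dv_def g_def lc_def)
  moreover have "\<not> n dvd 3 * a" "\<not> n dvd c" using no_triangles[OF H] by auto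
  ultimately have "n dvd 3 * a - c" using dvd_half c by blast
  then have "dv n g 3 0 (- 1) 0" by (simp del: dv_mod2[OF c'] add: dv_def g_def lc_def)
  then show False by simp
qed

text \<open>Here \<open>e\<close> has order two. The equations for walks of length four end in both
  \<open>2 * c = 0\<close> and \<open>2 * c + e = 0\<close>.\<close>

lemma no_involution_shift_a:
  assumes H: "WH_edge_trans n a a c (c + e)" and e: "n dvd 2 * e"
  shows False
proof -
  define g where "g = (a, c, e, 0::int)"
  have lc: "a = lc g 1 0 0 0" "a = lc g 1 0 0 0" "c = lc g 0 1 0 0" "c + e = lc g 0 1 1 0"
    by (simp_all add: g_def lc_def)
  have e': "dv n g 0 0 2 0" using e by (simp add: dv_def g_def lc_def)
  note [simp] = walks_lc[OF lc] walks_0_lc[OF lc] dv_sign dv_mod2[OF e']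
  note basic [simp] = basic_lc[OF H lc, simplified]
  note E2 = local_walks_lc[OF lc H, of "Suc (Suc 0)", simplified, unfolded nadd_def, simplified]
  note [simp] = E2(1)
  note E = local_walks_lc(1,2)[OF lc H, of "Suc (Suc (Suc (Suc 0)))", simplified, unfolded nadd_def, simplified]
  have e0: "\<not> dv n g 0 0 1 0" using basic by simp
  \<comment> \<open>\<open>a + c\<close> and \<open>a + c + e\<close> cannot both vanish, yet walks
    of length two make each vanish if the other does. With both excluded, the same equations exclude
    the two relations on \<open>2 * a - 2 * c\<close>.\<close>
  have 1: "\<not> dv n g 2 (- 2) 0 0" "\<not> dv n g 2 (- 2) 1 0" "\<not> dv n g 1 1 0 0" "\<not> dv n g 1 1 1 0"
  proof -
    have "\<not> (dv n g 1 1 0 0 \<and> dv n g 1 1 1 0)"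
      using e0 dv_lincomb[of n g 1 1 1 0 1 1 0 0 0 1 "- 1" 0 1 0] by auto
    moreover have "of_bool (dv n g 1 1 0 0) = (of_bool (dv n g 1 1 1 0) :: nat)"
      using E2(3,4) by linarith
    ultimately show *: "\<not> dv n g 1 1 0 0" "\<not> dv n g 1 1 1 0" unfolding of_bool_eq_iff by blast+
    have "of_bool (dv n g 2 (- 2) 0 0) = (0::nat)" "of_bool (dv n g 2 (- 2) 1 0) = (0::nat)"
      using E2(3)[simplified * of_bool_eq] by linarith+
    then show "\<not> dv n g 2 (- 2) 0 0" "\<not> dv n g 2 (- 2) 1 0" unfolding of_bool_eq_0_iff .
  qed
  have 2: "\<not> dv n g 2 0 1 0"
  proof
    assume *: "dv n g 2 0 1 0"
    have "dv n g 4 0 0 0" by (rule dv_lincomb[OF * e', of _ 2 "- 1"]) simp_all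
    then show False using E2(1) by simp
  qed
  \<comment> \<open>Exactly one of \<open>3 * a = c\<close> and \<open>3 * a = c + e\<close> (modulo
    \<open>n\<close>) holds; inserted into the first equation this asks for two further
    walks.\<close>
  have 3: "of_bool (dv n g 3 (- 1) 0 0) + of_bool (dv n g 3 (- 1) 1 0) = (1 :: nat)"
    using E(2)[simplified 1 2 of_bool_eq] by linarith
  have "2 \<le> of_bool (dv n g 0 2 0 0) + (of_bool (dv n g 0 2 1 0) :: nat)"
    using E(1) 3 by linarith
  then have 4: "dv n g 0 2 1 0" "dv n g 0 2 0 0" unfolding of_bool_add_ge_2 by blast+
  have "dv n g 0 0 1 0" by (rule dv_lincomb[OF 4, of _ 1 "- 1"]) simp_all
  then show False using e0 by blast
qed

text \<open>If \<open>2 * c = b + d\<close>, then \<open>C c\<close> and \<open>C d\<close> have two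
  common neighbours, hence so have \<open>A 0\<close> and \<open>C b\<close>, which means
  \<open>b = a\<close> or \<open>b = - a\<close>. The same holds for \<open>d\<close>, so
  \<open>b\<close> and \<open>d\<close> are \<open>a\<close> and \<open>- a\<close> in some order
  and \<open>2 * c = 0\<close>.\<close>

lemma no_arith_progression:
  assumes H: "WH_edge_trans n a b c d"
  shows "\<not> n dvd 2 * c - b - d"
proof
  assume r: "n dvd 2 * c - b - d"
  define g where "g = (a, b, c, d)"
  have lc: "a = lc g 1 0 0 0" "b = lc g 0 1 0 0" "c = lc g 0 0 1 0" "d = lc g 0 0 0 1"
    by (simp_all add: g_def lc_def)
  have r': "dv n g 0 1 (- 2) 1"
    using r dvd_minus_iff[of n "2 * c - b - d"] by (simp add: dv_def g_def lc_def algebra_simps)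
  note basic [simp] = basic_lc[OF H lc, simplified]
  note [simp] = walks_lc[OF lc] walks_0_lc[OF lc] dv_sign r'
  note E = local_walks_lc(2,4)[OF lc H, of "Suc (Suc 0)", simplified, unfolded nadd_def, simplified]
  have "dv n g 1 1 0 0 \<or> dv n g 1 (- 1) 0 0" "dv n g 1 0 0 1 \<or> dv n g 1 0 0 (- 1)"
    using E by (blast dest: of_bool_add_SucD)+
  then have ba: "n dvd b + a \<or> n dvd b - a" and da: "n dvd d + a \<or> n dvd d - a"
    by (auto simp: dv_def g_def lc_def dvd_diff_commute add.commute)
  have bd: "\<not> n dvd b - d" using H by (simp add: WH_edge_trans_def)
  show False
  proof (cases "n dvd b - a")
    case True
    then have d: "n dvd d + a" using da bd dvd_diff[of n "b - a" "d - a"] by auto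
    have "n dvd 2 * c"
      using dvd_add[OF dvd_add[OF r True] d] by (simp add: algebra_simps)
    moreover have "WH_edge_trans n a a c (- a)"
      using WH_edge_trans_cong[OF H, of a a c "- a"] True d by simp
    ultimately show False using no_involution_pair_a by blast
  next
    case False
    then have b: "n dvd b + a" using ba by blast
    then have d: "n dvd d - a" using da bd dvd_diff[of n "b + a" "d + a"] by auto
    have "n dvd 2 * c"
      using dvd_add[OF dvd_add[OF r b] d] by (simp add: algebra_simps)
    moreover have "WH_edge_trans n (- a) (- a) c (- (- a))"
      using WH_edge_trans_cong[OF WH_edge_trans_swap(3)[OF H], of "- a" "- a" c a] b d by simp
    ultimately show False using no_involution_pair_a by blast
  qed
qed

text \<open>Again \<open>C c\<close> and \<open>C d\<close> have a second common neighbour, so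
  \<open>b\<close> is \<open>a\<close> or \<open>- a\<close>, and \<open>d - c\<close> has order
  two.\<close>

lemma no_half_difference:
  assumes H: "WH_edge_trans n a b c d"
  shows "\<not> n dvd 2 * (c - d)"
proof
  assume q: "n dvd 2 * (c - d)"
  define g where "g = (a, b, c, d)"
  have lc: "a = lc g 1 0 0 0" "b = lc g 0 1 0 0" "c = lc g 0 0 1 0" "d = lc g 0 0 0 1"
    by (simp_all add: g_def lc_def)
  have q': "dv n g 0 0 2 (- 2)" using q by (simp add: dv_def g_def lc_def algebra_simps)
  note basic [simp] = basic_lc[OF H lc, simplified]
  note [simp] = walks_lc[OF lc] walks_0_lc[OF lc] dv_sign q'
  note E = local_walks_lc(2)[OF lc H, of "Suc (Suc 0)", simplified, unfolded nadd_def, simplified]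
  have "dv n g 1 1 0 0 \<or> dv n g 1 (- 1) 0 0"
    using E by (blast dest: of_bool_add_SucD)
  then have ba: "n dvd b + a \<or> n dvd b - a"
    by (auto simp: dv_def g_def lc_def dvd_diff_commute add.commute)
  then have "WH_edge_trans n a a c (c + (d - c)) \<or> WH_edge_trans n (- a) (- a) c (c + (d - c))"
    using WH_edge_trans_cong[OF H, of a a c d] WH_edge_trans_cong[OF WH_edge_trans_swap(3)[OF H], of "- a" "- a" c d]
    by auto
  moreover have "n dvd 2 * (d - c)" using q by (metis dvd_minus_iff minus_diff_eq mult_minus_right)
  ultimately show False using no_involution_shift_a by blast
qed

text \<open>With the relations among \<open>b\<close>, \<open>c\<close>, \<open>d\<close> alone
  excluded, two of the vertices \<open>C b\<close>, \<open>C c\<close>, \<open>C d\<close> have one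
  common neighbour. The equations for walks of length two then rule out \<open>x + a = 0\<close> and
  \<open>x - a = 0\<close>.\<close>

lemma edge_trans_no_short_cycles:
  assumes H: "WH_edge_trans n a b c d"
  shows "no_short_cycles n a b c d"
proof -
  define g where "g = (a, b, c, d)"
  have lc: "a = lc g 1 0 0 0" "b = lc g 0 1 0 0" "c = lc g 0 0 1 0" "d = lc g 0 0 0 1"
    by (simp_all add: g_def lc_def)
  note sw = WH_edge_trans_swap(1,2)
  have r: "\<not> n dvd 2 * b - c - d" "\<not> n dvd 2 * c - b - d" "\<not> n dvd 2 * d - b - c"
    using no_arith_progression[OF H] no_arith_progression[OF sw(2)[OF H]] no_arith_progression[OF sw(1)[OF H]]
    by (simp_all add: algebra_simps)
  have q: "\<not> n dvd 2 * (b - c)" "\<not> n dvd 2 * (b - d)" "\<not> n dvd 2 * (c - d)"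
    using no_half_difference[OF H] no_half_difference[OF sw(1)[OF H]] no_half_difference[OF sw(1)[OF sw(2)[OF H]]]
    by auto
  have rq: "\<not> dv n g 0 2 (- 1) (- 1)" "\<not> dv n g 0 1 (- 2) 1" "\<not> dv n g 0 1 1 (- 2)"
    "\<not> dv n g 0 2 (- 2) 0" "\<not> dv n g 0 2 0 (- 2)" "\<not> dv n g 0 0 2 (- 2)"
    using r q dvd_minus_iff[of n "2 * c - b - d"] dvd_minus_iff[of n "2 * d - b - c"]
    by (simp_all add: dv_def g_def lc_def algebra_simps)
  note basic [simp] = basic_lc[OF H lc, simplified]
  note [simp] = walks_lc[OF lc] walks_0_lc[OF lc] dv_sign rq
  note E = local_walks_lc(1-4)[OF lc H, of "Suc (Suc 0)", simplified, unfolded nadd_def, simplified]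
  have "\<not> n dvd 2 * a" "\<not> n dvd 3 * a" "\<not> n dvd 4 * a"
    using H no_triangles[OF H] E(1) by (simp_all add: WH_edge_trans_def dv_def g_def lc_def)
  moreover have "\<not> n dvd x + a \<and> \<not> n dvd x - a" if "x \<in> {b, c, d}" for x
  proof -
    have "\<not> dv n g 1 1 0 0" "\<not> dv n g (- 1) 1 0 0" "\<not> dv n g 1 0 1 0" "\<not> dv n g (- 1) 0 1 0"
      "\<not> dv n g 1 0 0 1" "\<not> dv n g (- 1) 0 0 1"
      using E(2-4) by auto
    then show ?thesis using that by (auto simp add: dv_def g_def lc_def algebra_simps)
  qed
  ultimately show ?thesis
    unfolding no_short_cycles_def using no_triangles[OF H] r q by blast
qed

section \<open>Walks of length four\<close>

text \<open>The pair \<open>x\<close>, \<open>- x\<close> closes hexagons through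
  \<open>B 0\<close>, \<open>A 0\<close>, \<open>C 0\<close>, giving two additional walks of length
  four, or three if \<open>2 * z = 0\<close>. Hexagons through \<open>A (- a)\<close>,
  \<open>A 0\<close>, \<open>A a\<close> must match them. Besides the listed relations these come
  only from \<open>6 * a = 0\<close>, with one walk, and from \<open>3 * a = x\<close> or
  \<open>3 * a = - x\<close>, with four walks each; those numbers never match.\<close>

lemma opposite_pair_cases:
  assumes H: "WH_edge_trans n a x (- x) z"
  shows "n dvd 3 * a - z \<or> n dvd 3 * a + z \<or> n dvd 2 * a - 2 * x \<or> n dvd 2 * a + 2 * x \<or>
    n dvd 2 * a - x + z \<or> n dvd 2 * a - x - z \<or> n dvd 2 * a + x + z \<or> n dvd 2 * a + x - z"
proof (rule ccontr)
  assume neg0: "\<not> ?thesis"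
  define g where "g = (a, x, z, 0::int)"
  have lc: "a = lc g 1 0 0 0" "x = lc g 0 1 0 0" "- x = lc g 0 (- 1) 0 0" "z = lc g 0 0 1 0"
    by (simp_all add: g_def lc_def)
  have neg [simp]: "\<not> dv n g 3 0 (- 1) 0" "\<not> dv n g 3 0 1 0" "\<not> dv n g 2 (- 2) 0 0" "\<not> dv n g 2 2 0 0"
    "\<not> dv n g 2 (- 1) 1 0" "\<not> dv n g 2 (- 1) (- 1) 0" "\<not> dv n g 2 1 1 0" "\<not> dv n g 2 1 (- 1) 0"
    using neg0 by (simp_all add: dv_def g_def lc_def)
  note facts [simp] = no_short_cycles_lc[OF edge_trans_no_short_cycles[OF H] lc, simplified, unfolded dv_sign, simplified]
  note [simp] = walks_lc[OF lc] walks_0_lc[OF lc] dv_sign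
  note E = local_walks_lc(1)[OF lc H, of "Suc (Suc (Suc (Suc 0)))", simplified, unfolded nadd_def, simplified]
  show False using E by (cases "dv n g 6 0 0 0"; cases "dv n g 3 1 0 0"; cases "dv n g 3 (- 1) 0 0") simp_all
qed

text \<open>\<open>2 * b = 0\<close> adds a single walk from \<open>B 0\<close> to
  \<open>C 0\<close>, whereas the additional walks from \<open>A (- a)\<close> to \<open>A a\<close>
  come in pairs, except the one due to \<open>6 * a = 0\<close>.\<close>

lemma no_involution:
  assumes H: "WH_edge_trans n a b c d" and s: "\<not> n dvd b + c" "\<not> n dvd b + d" "\<not> n dvd c + d"
  shows "\<not> n dvd 2 * b"
proof
  assume b: "n dvd 2 * b"
  define g where "g = (a, b, c, d)"
  have lc: "a = lc g 1 0 0 0" "b = lc g 0 1 0 0" "c = lc g 0 0 1 0" "d = lc g 0 0 0 1"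
    by (simp_all add: g_def lc_def)
  note N = edge_trans_no_short_cycles[OF H]
  note facts [simp] = no_short_cycles_lc[OF N lc, simplified, unfolded dv_sign, simplified]
  have "\<not> n dvd 2 * c" "\<not> n dvd 2 * d"
    using b N dvd_diff[OF b] by (auto simp: no_short_cycles_def algebra_simps)
  then have [simp]: "dv n g 0 2 0 0" "\<not> dv n g 0 0 2 0" "\<not> dv n g 0 0 0 2"
    "\<not> dv n g 0 1 1 0" "\<not> dv n g 0 1 0 1" "\<not> dv n g 0 0 1 1"
    using b s by (simp_all add: dv_def g_def lc_def)
  note [simp] = walks_lc[OF lc] walks_0_lc[OF lc] dv_sign
  note E = local_walks_lc(1)[OF lc H, of "Suc (Suc (Suc (Suc 0)))", simplified, unfolded nadd_def, simplified]
  \<comment> \<open>Modulo 2, \<open>E\<close> says that \<open>6a = 0\<close>; then \<open>3a\<close> and \<open>b\<close> are both the element of order two.\<close>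
  have E': "\<not> dv n g 3 (- 1) 0 0"
  proof
    assume [simp]: "dv n g 3 (- 1) 0 0"
    show False using E by simp
  qed
  have "dv n g 6 0 0 0"
  proof (rule ccontr)
    assume [simp]: "\<not> dv n g 6 0 0 0"
    have "even (1 :: nat)" using E by simp presburger
    then show False by simp
  qed
  then have "n dvd 2 * (3 * a)" by (simp add: dv_def g_def lc_def)
  then have "n dvd 3 * a - b" using dvd_half[OF _ b] N by (simp add: no_short_cycles_def)
  then show False using E' by (simp add: dv_def g_def lc_def)
qed

text \<open>For all parameters \<open>C c\<close>, \<open>B 0\<close>, \<open>C d\<close> lie on the
  hexagon whose steps use \<open>b\<close>, \<open>c\<close>, \<open>d\<close> once in each
  direction, and likewise for the other two pairs. If no two parameters, equal or not, add up to
  zero, no hexagon passes through \<open>B 0\<close>, \<open>A 0\<close>, \<open>C 0\<close> to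
  match it.\<close>

lemma opposite_pair:
  assumes H: "WH_edge_trans n a b c d"
  shows "n dvd b + c \<or> n dvd b + d \<or> n dvd c + d"
proof (rule ccontr)
  assume s: "\<not> ?thesis"
  define g where "g = (a, b, c, d)"
  have lc: "a = lc g 1 0 0 0" "b = lc g 0 1 0 0" "c = lc g 0 0 1 0" "d = lc g 0 0 0 1"
    by (simp_all add: g_def lc_def)
  note facts [simp] = no_short_cycles_lc[OF edge_trans_no_short_cycles[OF H] lc, simplified, unfolded dv_sign, simplified]
  have "\<not> n dvd 2 * b" "\<not> n dvd 2 * c" "\<not> n dvd 2 * d"
    using no_involution[OF H] no_involution[OF WH_edge_trans_swap(1)[OF H]]
      no_involution[OF WH_edge_trans_swap(1)[OF WH_edge_trans_swap(2)[OF H]]] s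
    by (auto simp: add.commute)
  then have [simp]: "\<not> dv n g 0 2 0 0" "\<not> dv n g 0 0 2 0" "\<not> dv n g 0 0 0 2"
    "\<not> dv n g 0 1 1 0" "\<not> dv n g 0 1 0 1" "\<not> dv n g 0 0 1 1"
    using s by (simp_all add: dv_def g_def lc_def)
  note [simp] = walks_lc[OF lc] walks_0_lc[OF lc] dv_sign
  define w where "w = walks n a b c d (Suc (Suc (Suc (Suc 0))))"
  \<comment> \<open>Ten is the number of walks of length four between vertices at distance two in
    the 4-valent tree.\<close>
  have BC: "w (B (lc g 0 0 0 0)) (C (lc g 0 0 0 0)) = 10"
    unfolding w_def by (simp, simp add: nadd_def)
  have "w (C (lc g 0 0 1 0)) (C (lc g 0 0 0 1)) \<noteq> 10"
  proof
    assume eq: "w (C (lc g 0 0 1 0)) (C (lc g 0 0 0 1)) = 10"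
    show False using eq[unfolded w_def, simplified, unfolded nadd_def] by linarith
  qed
  moreover have "w (C (lc g 0 1 0 0)) (C (lc g 0 0 0 1)) \<noteq> 10"
  proof
    assume eq: "w (C (lc g 0 1 0 0)) (C (lc g 0 0 0 1)) = 10"
    show False using eq[unfolded w_def, simplified, unfolded nadd_def] by linarith
  qed
  moreover have "w (C (lc g 0 1 0 0)) (C (lc g 0 0 1 0)) \<noteq> 10"
  proof
    assume eq: "w (C (lc g 0 1 0 0)) (C (lc g 0 0 1 0)) = 10"
    show False using eq[unfolded w_def, simplified, unfolded nadd_def] by linarith
  qed
  ultimately show False
    using local_walks_lc(1-5)[OF lc H, of "Suc (Suc (Suc (Suc 0)))", folded w_def] BC by metis
qed

lemma no_triple_opposite_pair:
  assumes H: "WH_edge_trans n a x (- x) (3 * a)"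
  shows False
proof -
  define g where "g = (a, x, 0::int, 0::int)"
  have lc: "a = lc g 1 0 0 0" "x = lc g 0 1 0 0" "- x = lc g 0 (- 1) 0 0" "3 * a = lc g 3 0 0 0"
    by (simp_all add: g_def lc_def)
  note facts = no_short_cycles_lc[OF edge_trans_no_short_cycles[OF H] lc, simplified, unfolded dv_sign, simplified]
  note [simp] = walks_lc[OF lc] walks_0_lc[OF lc] dv_sign facts
  note E = local_walks_lc[OF lc H, of "Suc (Suc (Suc (Suc 0)))", simplified, unfolded nadd_def, simplified]
  \<comment> \<open>\<open>z = 3 * a\<close> already supplies the two walks that \<open>x\<close>,
    \<open>- x\<close> require, so no further relation may contribute.\<close>
  have E1: "\<not> dv n g 2 (- 2) 0 0" "\<not> dv n g 2 2 0 0" "\<not> dv n g 5 (-1) 0 0" "\<not> dv n g 5 1 0 0" "\<not> dv n g 6 0 0 0"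
    using E(1) by simp_all
  note E = E(2-)[simplified E1 of_bool_eq, simplified]
  have ex': "\<not> (dv n g 7 1 0 0 \<and> dv n g 7 (- 1) 0 0 \<and> (dv n g 1 3 0 0 \<or> dv n g 1 (- 3) 0 0))"
  proof
    assume *: "dv n g 7 1 0 0 \<and> dv n g 7 (- 1) 0 0 \<and> (dv n g 1 3 0 0 \<or> dv n g 1 (- 3) 0 0)"
    then have "dv n g 7 3 0 0" "dv n g 7 (- 3) 0 0"
      by (auto intro: dv_lincomb[of n g 7 1 0 0 7 "- 1" 0 0 _ 2 "- 1"] dv_lincomb[of n g 7 1 0 0 7 "- 1" 0 0 _ "- 1" 2])
    then have "dv n g 6 0 0 0"
      using * dv_lincomb[of n g 7 3 0 0 1 3 0 0 6 1 "- 1" 0 0 0] dv_lincomb[of n g 7 "- 3" 0 0 1 "- 3" 0 0 6 1 "- 1" 0 0 0]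
      by auto
    then show False using E1 by simp
  qed
  have p: "\<not> dv n g 1 3 0 0" "\<not> dv n g 1 (- 3) 0 0"
  proof -
    have "\<not> (dv n g 1 3 0 0 \<or> dv n g 1 (- 3) 0 0)"
    proof
      assume *: "dv n g 1 3 0 0 \<or> dv n g 1 (- 3) 0 0"
      then have "1 \<le> of_bool (dv n g 1 3 0 0) + (of_bool (dv n g 1 (- 3) 0 0) :: nat)" by auto
      then have "2 \<le> of_bool (dv n g 7 (- 1) 0 0) + (of_bool (dv n g 7 1 0 0) :: nat)"
        using E(3) by linarith
      then have "dv n g 7 (- 1) 0 0 \<and> dv n g 7 1 0 0" unfolding of_bool_add_ge_2 .
      then show False using * ex' by blast
    qed
    then show "\<not> dv n g 1 3 0 0" "\<not> dv n g 1 (- 3) 0 0" by blast+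
  qed
  note E = E(1,2,4)[simplified p of_bool_eq add_0_left]
  \<comment> \<open>Either both or neither of \<open>4 * a + 2 * x\<close> and
    \<open>4 * a - 2 * x\<close> vanish; in both cases the disjunction in
    \<open>local_walks_lc\<close> fails.\<close>
  have "of_bool (dv n g 4 2 0 0) = (of_bool (dv n g 4 (- 2) 0 0) :: nat)"
    "of_bool (dv n g 7 1 0 0) = (0::nat)" "of_bool (dv n g 7 (- 1) 0 0) = (0::nat)"
    using E(1,2) by linarith+
  then show False using E(3) by (cases "dv n g 4 2 0 0") simp_all
qed

lemma no_shifted_opposite_pair:
  assumes H: "WH_edge_trans n a x (- x) (x + 2 * a)"
  shows False
proof -
  define g where "g = (a, x, 0::int, 0::int)"
  have lc: "a = lc g 1 0 0 0" "x = lc g 0 1 0 0" "- x = lc g 0 (- 1) 0 0" "x + 2 * a = lc g 2 1 0 0"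
    by (simp_all add: g_def lc_def)
  note facts = no_short_cycles_lc[OF edge_trans_no_short_cycles[OF H] lc, simplified, unfolded dv_sign, simplified]
  note [simp] = walks_lc[OF lc] walks_0_lc[OF lc] dv_sign facts
  note E = local_walks_lc[OF lc H, of "Suc (Suc (Suc (Suc 0)))", simplified, unfolded nadd_def, simplified]
  note E = E(2-)[simplified E(1) of_bool_eq, simplified]
  \<comment> \<open>The equation for \<open>C x\<close> would turn \<open>3 * a + 3 * x = 0\<close>
    into \<open>a - 3 * x = 0\<close> as well, and the sum of the two is
    \<open>4 * a = 0\<close>.\<close>
  have "\<not> dv n g 3 3 0 0"
  proof
    assume *: "dv n g 3 3 0 0"
    then have "of_bool (dv n g 1 (- 3) 0 0) \<noteq> (0 :: nat)" using E(1) by simp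
    then have "dv n g 1 (- 3) 0 0" unfolding of_bool_eq_0_iff by blast
    then have "dv n g 4 0 0 0"
      by (rule dv_lincomb[OF *, of _ _ _ _ _ 1 1]) simp_all
    then show False by simp
  qed
  then have 3: "of_bool (dv n g 3 3 0 0) = (0::nat)" by simp
  have "of_bool (dv n g 5 3 0 0) \<le> (1::nat)" by simp
  then have "of_bool (dv n g 1 3 0 0) = (0::nat)" "of_bool (dv n g 1 (- 3) 0 0) = (0::nat)"
    using E(3) 3 by linarith+
  then show False using E(2) 3 by linarith
qed

text \<open>The case \<open>2 * x = 2 * a\<close>, written with \<open>h = x - a\<close> of order
  two, so that \<open>- x\<close> becomes \<open>h - a\<close>.\<close>

lemma involution_family:
  assumes H: "WH_edge_trans n a (h + a) (h - a) z"
    and h: "n dvd 2 * h" "\<not> n dvd h"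
  shows "n dvd 2 * z - h \<and> \<not> n dvd 4 * a - h"
proof -
  define g where "g = (a, z, h, 0::int)"
  have lc: "a = lc g 1 0 0 0" "h + a = lc g 1 0 1 0" "h - a = lc g (- 1) 0 1 0" "z = lc g 0 1 0 0"
    by (simp_all add: g_def lc_def)
  have h': "dv n g 0 0 2 0" "\<not> dv n g 0 0 1 0" using h by (simp_all add: dv_def g_def lc_def)
  note facts = no_short_cycles_lc[OF edge_trans_no_short_cycles[OF H] lc, simplified, unfolded dv_sign, simplified dv_mod2[OF h'(1)], simplified]
  note [simp] = walks_lc[OF lc] walks_0_lc[OF lc] dv_sign facts h' dv_mod2[OF h'(1)]
  note E = local_walks_lc[OF lc H, of "Suc (Suc (Suc (Suc 0)))", simplified, unfolded nadd_def, simplified]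
  note E' = E(1) and E = E(4)[simplified E(1) of_bool_eq, simplified]
  \<comment> \<open>Otherwise the equation for \<open>C z\<close> requires
    \<open>2 * a + 2 * z + h\<close> and \<open>2 * a - 2 * z + h\<close> both to vanish, and their
    sum is \<open>4 * a\<close>.\<close>
  have "dv n g 0 2 1 0"
  proof (rule ccontr)
    assume *: "\<not> dv n g 0 2 1 0"
    then have "2 \<le> of_bool (dv n g 2 2 1 0) + (of_bool (dv n g 2 (- 2) 1 0) :: nat)" using E by simp
    then have **: "dv n g 2 2 1 0" "dv n g 2 (- 2) 1 0" unfolding of_bool_add_ge_2 by blast+
    have "dv n g 4 0 2 0"
      by (rule dv_lincomb[OF **, of _ 1 1]) simp_all
    then show False by simp
  qed
  then have "dv n g 0 2 (- 1) 0" by simp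
  moreover have "\<not> dv n g 4 0 (- 1) 0" using E' by simp
  ultimately show ?thesis by (simp del: dv_mod2[OF h'(1)] add: dv_def g_def lc_def)
qed

section \<open>The antipodal family\<close>

lemma dv_mod4:
  assumes "dv n g 0 0 4 0"
  shows "\<not> (0 \<le> k \<and> k < 4) \<Longrightarrow> dv n g i j k l = dv n g i j (k mod 4) l"
proof -
  have k: "4 * (k div 4) + k mod 4 = k" by simp
  have "dv n g i j k l" if "dv n g i j (k mod 4) l"
    by (rule dv_lincomb[OF that assms, of _ 1 "k div 4"]) (use k in auto)
  moreover have "dv n g i j (k mod 4) l" if "dv n g i j k l"
    by (rule dv_lincomb[OF that assms, of _ 1 "- (k div 4)"]) (use k in linarith)+
  ultimately show ?thesis by blast
qed

lemma walks_target_cong: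
  assumes "red n v = red n v'"
  shows "walks n a b c d k u v = walks n a b c d k u v'"
proof (induction k arbitrary: u)
  case (Suc k)
  then show ?case by (cases u) (simp_all add: walks.simps)
qed (simp add: walks.simps assms del: red.simps)

context
  fixes n a z :: int
  assumes H: "WH_edge_trans n a (2 * z + a) (2 * z - a) z"
    and z: "n dvd 4 * z" and az: "\<not> n dvd 4 * a - 2 * z"
begin

text \<open>The free slot \<open>t\<close> is the index of an arbitrary end vertex, so that one
  expansion of the walks treats all ends at once.\<close>

private definition g :: "int \<Rightarrow> int \<times> int \<times> int \<times> int" where "g t = (a, t, z, 0)"
private definition w where "w = walks n a (2 * z + a) (2 * z - a) z (Suc (Suc (Suc (Suc 0))))"

private lemma lc: "a = lc (g t) 1 0 0 0" "2 * z + a = lc (g t) 1 0 2 0"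
  "2 * z - a = lc (g t) (- 1) 0 2 0" "z = lc (g t) 0 0 1 0"
  by (simp_all add: g_def lc_def)

private lemma z4: "dv n (g t) 0 0 4 0"
  using z by (simp add: dv_def g_def lc_def)

private lemma coincidences:
  "\<not> dv n (g t) 1 0 0 0" "\<not> dv n (g t) 2 0 0 0" "\<not> dv n (g t) 3 0 0 0" "\<not> dv n (g t) 4 0 0 0"
  "\<not> dv n (g t) 0 0 1 0" "\<not> dv n (g t) 0 0 2 0" "\<not> dv n (g t) 0 0 3 0"
  "\<not> dv n (g t) 1 0 1 0" "\<not> dv n (g t) 1 0 2 0" "\<not> dv n (g t) 1 0 3 0" "\<not> dv n (g t) 2 0 2 0"
  "\<not> dv n (g t) 3 0 1 0" "\<not> dv n (g t) 3 0 3 0" "\<not> dv n (g t) 4 0 2 0"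
proof -
  note [simp] = dv_sign dv_mod4[OF z4]
  note facts = no_short_cycles_lc[OF edge_trans_no_short_cycles[OF H] lc, simplified]
  show "\<not> dv n (g t) 1 0 0 0" "\<not> dv n (g t) 2 0 0 0" "\<not> dv n (g t) 3 0 0 0" "\<not> dv n (g t) 4 0 0 0"
    "\<not> dv n (g t) 0 0 1 0" "\<not> dv n (g t) 0 0 2 0"
    "\<not> dv n (g t) 1 0 1 0" "\<not> dv n (g t) 1 0 2 0" "\<not> dv n (g t) 1 0 3 0" "\<not> dv n (g t) 2 0 2 0"
    "\<not> dv n (g t) 3 0 1 0" "\<not> dv n (g t) 3 0 3 0"
    using facts[of t] by simp_all
  show "\<not> dv n (g t) 0 0 3 0"
    using \<open>\<not> dv n (g t) 0 0 1 0\<close> dv_neg[of n "g t" 0 0 1 0] dv_mod4[OF z4, of "- 1" t 0 0 0]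
    by (simp del: dv_mod4[OF z4] dv_sign)
  show "\<not> dv n (g t) 4 0 2 0"
    using az dv_mod4[OF z4, of "- 2" t 4 0 0] by (simp add: dv_def g_def lc_def del: dv_mod4[OF z4])
qed

private lemmas walks_simps = walks_lc[OF lc] walks_0_lc[OF lc] dv_sign z4 dv_mod4[OF z4] coincidences

private lemma six: "\<not> dv n (g t) 6 0 0 0"
proof -
  note [simp] = walks_simps
  have "\<not> dv n (g 0) 6 0 0 0"
    using local_walks_lc(1)[OF lc H, of "Suc (Suc (Suc (Suc 0)))" 0, simplified, unfolded nadd_def, simplified] .
  then show ?thesis by (simp add: dv_def g_def lc_def)
qed

text \<open>Otherwise \<open>3 * a - z\<close> would be the element \<open>2 * z\<close> of order
  two, giving the excluded relation \<open>3 * a = 3 * z\<close>.\<close>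

private lemma six': "\<not> dv n (g t) 6 0 2 0"
proof
  note [simp] = walks_simps
  assume "dv n (g t) 6 0 2 0"
  then have "dv n (g t) 6 0 (- 2) 0" by simp
  then have "n dvd 2 * (3 * a - z)" by (simp add: dv_def g_def lc_def algebra_simps del: dv_mod4[OF z4])
  moreover have "n dvd 2 * (2 * z)" using z by simp
  moreover have "\<not> dv n (g t) 3 0 (- 1) 0" by simp
  then have "\<not> n dvd 3 * a - z" by (simp add: dv_def g_def lc_def del: dv_mod4[OF z4])
  moreover have "\<not> n dvd 2 * z" using coincidences(6)[of t] by (simp add: dv_def g_def lc_def)
  ultimately have "n dvd 3 * a - z - 2 * z" using dvd_half by blast
  then have "dv n (g t) 3 0 (- 3) 0" by (simp add: dv_def g_def lc_def del: dv_mod4[OF z4])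
  then show False by simp
qed

private lemma dv_excl:
  assumes "\<not> dv n (g t) (i - i') (j - j') (k - k') (l - l')"
  shows "\<not> (dv n (g t) i j k l \<and> dv n (g t) i' j' k' l')"
  using assms dv_lincomb[of n "g t" i j k l i' j' k' l' "i - i'" 1 "- 1" "j - j'" "k - k'" "l - l'"] by auto

private lemma at_most_one:
  assumes "\<not> dv n (g t) (i - i') (j - j') (k - k') (l - l')"
  shows "of_bool (dv n (g t) i j k l) + of_bool (dv n (g t) i' j' k' l') \<le> (1 :: nat)"
  using dv_excl[OF assms] by auto

text \<open>Walks of length 4 with a prescribed end are paired by permuting their steps; only few ends
  are left unpaired, and none of them is reached by exactly eight walks from \<open>A a\<close>.\<close>

private lemma even_walks_twin_A:
  assumes v: "w (A (lc (g t) 1 0 0 0)) (A (lc (g t) 0 1 0 0)) = 8" "odd (w (A (lc (g t) (- 1) 0 0 0)) (A (lc (g t) 0 1 0 0)))"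
  shows False
proof -
  note [simp] = walks_simps six six'
  have cong: "w u v = w u v'" if "red n v = red n v'" for u v v'
    unfolding w_def by (rule walks_target_cong[OF that])
  \<comment> \<open>The unpaired ends are \<open>A (- 5 * a)\<close> and \<open>A (3 * a)\<close>,
    reached from \<open>A (- a)\<close> by four equal steps along \<open>A\<close>-vertices.\<close>
  have "dv n (g t) 5 1 0 0 \<or> dv n (g t) 3 (- 1) 0 0"
  proof (rule ccontr)
    assume none: "\<not> ?thesis"
    define m where "m = w (A (lc (g t) (- 1) 0 0 0)) (A (lc (g t) 0 1 0 0))"
    have none': "of_bool (dv n (g t) 5 1 0 0) = (0::nat)" "of_bool (dv n (g t) 3 (- 1) 0 0) = (0::nat)"
      using none by simp_all
    have "m = 2 * (2 * of_bool (dv n (g t) 0 1 1 0) + 2 * of_bool (dv n (g t) 0 1 3 0) + 6 * of_bool (dv n (g t) 1 (- 1) 0 0) + 2 * of_bool (dv n (g t) 1 (- 1) 2 0) + 14 * of_bool (dv n (g t) 1 1 0 0) + 4 * of_bool (dv n (g t) 1 1 2 0) + 2 * of_bool (dv n (g t) 2 1 1 0) + 2 * of_bool (dv n (g t) 2 1 3 0) + 6 * of_bool (dv n (g t) 3 1 0 0) + 2 * of_bool (dv n (g t) 3 1 2 0))"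
      using m_def[symmetric, unfolded w_def, simplified, unfolded nadd_def] none' by (simp del: walks_simps)
    then have "even m" by (simp only: dvd_triv_left)
    then show False using v(2) unfolding m_def by blast
  qed
  then show False
  proof
    assume 5: "dv n (g t) 5 1 0 0"
    have "red n (A (lc (g t) 0 1 0 0)) = red n (A (lc (g t) (- 5) 0 0 0))"
      unfolding red_eq_iff lc_diff dv_def[symmetric] using 5 by simp
    then have "w (A (lc (g t) 1 0 0 0)) (A (lc (g t) (- 5) 0 0 0)) = 8" using v(1) cong by metis
    note eq = this[unfolded w_def, simplified, unfolded nadd_def]
    \<comment> \<open>The five relations exclude one another and each gives four walks.
      \<open>8 * a = 0\<close> alone would give more than eight, and the single walk from
      \<open>10 * a = 0\<close> contradicts divisibility by four.\<close>
    have one: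
      "of_bool (dv n (g t) 8 0 2 0) + of_bool (dv n (g t) 7 0 1 0) \<le> (1::nat)"
      "of_bool (dv n (g t) 8 0 2 0) + of_bool (dv n (g t) 7 0 3 0) \<le> (1::nat)"
      "of_bool (dv n (g t) 8 0 2 0) + of_bool (dv n (g t) 5 0 1 0) \<le> (1::nat)"
      "of_bool (dv n (g t) 8 0 2 0) + of_bool (dv n (g t) 5 0 3 0) \<le> (1::nat)"
      "of_bool (dv n (g t) 7 0 1 0) + of_bool (dv n (g t) 7 0 3 0) \<le> (1::nat)"
      "of_bool (dv n (g t) 7 0 1 0) + of_bool (dv n (g t) 5 0 1 0) \<le> (1::nat)"
      "of_bool (dv n (g t) 7 0 1 0) + of_bool (dv n (g t) 5 0 3 0) \<le> (1::nat)"
      "of_bool (dv n (g t) 7 0 3 0) + of_bool (dv n (g t) 5 0 1 0) \<le> (1::nat)"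
      "of_bool (dv n (g t) 7 0 3 0) + of_bool (dv n (g t) 5 0 3 0) \<le> (1::nat)"
      "of_bool (dv n (g t) 5 0 1 0) + of_bool (dv n (g t) 5 0 3 0) \<le> (1::nat)"
      by (rule at_most_one; simp)+
    have "of_bool (dv n (g t) 8 0 0 0) = (0::nat)" using eq by linarith
    moreover have "of_bool (dv n (g t) 10 0 0 0) = (0::nat)"
    proof (rule ccontr)
      assume "of_bool (dv n (g t) 10 0 0 0) \<noteq> (0::nat)"
      then have [simp]: "dv n (g t) 10 0 0 0" by simp
      define m :: nat where "m = of_bool (dv n (g t) 8 0 2 0) + of_bool (dv n (g t) 7 0 1 0) + of_bool (dv n (g t) 7 0 3 0) + of_bool (dv n (g t) 5 0 1 0) + of_bool (dv n (g t) 5 0 3 0)"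
      have "4 * m = 7" using eq calculation unfolding m_def by simp
      then show False by presburger
    qed
    moreover have "of_bool (dv n (g t) 8 0 2 0) + of_bool (dv n (g t) 7 0 1 0) + of_bool (dv n (g t) 7 0 3 0) + of_bool (dv n (g t) 5 0 1 0) + of_bool (dv n (g t) 5 0 3 0) \<le> (1::nat)"
      using one by (cases "dv n (g t) 8 0 2 0"; cases "dv n (g t) 7 0 1 0"; cases "dv n (g t) 7 0 3 0"; cases "dv n (g t) 5 0 1 0"; cases "dv n (g t) 5 0 3 0") (simp_all del: walks_simps)
    ultimately show False using eq by linarith
  next
    assume 3: "dv n (g t) 3 (- 1) 0 0"
    have "red n (A (lc (g t) 0 1 0 0)) = red n (A (lc (g t) 3 0 0 0))"
      unfolding red_eq_iff lc_diff dv_def[symmetric] using 3 by simp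
    then have "w (A (lc (g t) 1 0 0 0)) (A (lc (g t) 3 0 0 0)) = 8" using v(1) cong by metis
    note eq = this[unfolded w_def, simplified, unfolded nadd_def]
    show False using eq by simp
  qed
qed

private lemma even_walks_twin_B:
  assumes v: "w (A (lc (g t) 1 0 0 0)) (B (lc (g t) 0 1 0 0)) = 8" "odd (w (A (lc (g t) (- 1) 0 0 0)) (B (lc (g t) 0 1 0 0)))"
  shows False
proof -
  note [simp] = walks_simps six six'
  have cong: "w u v = w u v'" if "red n v = red n v'" for u v v'
    unfolding w_def by (rule walks_target_cong[OF that])
  \<comment> \<open>The only unpaired end is \<open>B (z - a)\<close>, because
    \<open>4 * z = 0\<close>; from \<open>A a\<close> it is reached by too few walks.\<close>
  have "dv n (g t) 1 1 3 0"
  proof (rule ccontr)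
    assume none: "\<not> ?thesis"
    define m where "m = w (A (lc (g t) (- 1) 0 0 0)) (B (lc (g t) 0 1 0 0))"
    have none': "of_bool (dv n (g t) 1 1 3 0) = (0::nat)"
      using none by simp_all
    have "m = 2 * (6 * of_bool (dv n (g t) 0 1 0 0) + 6 * of_bool (dv n (g t) 0 1 2 0) + of_bool (dv n (g t) 1 (- 1) 1 0) + 2 * of_bool (dv n (g t) 1 (- 1) 3 0) + 6 * of_bool (dv n (g t) 1 1 1 0) + 2 * of_bool (dv n (g t) 1 1 3 0) + of_bool (dv n (g t) 2 (- 1) 0 0) + of_bool (dv n (g t) 2 (- 1) 2 0) + 6 * of_bool (dv n (g t) 2 1 0 0) + 6 * of_bool (dv n (g t) 2 1 2 0) + 2 * of_bool (dv n (g t) 3 1 1 0) + of_bool (dv n (g t) 3 1 3 0) + of_bool (dv n (g t) 4 1 0 0) + of_bool (dv n (g t) 4 1 2 0))"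
      using m_def[symmetric, unfolded w_def, simplified, unfolded nadd_def] none' by (simp del: walks_simps)
    then have "even m" by (simp only: dvd_triv_left)
    then show False using v(2) unfolding m_def by blast
  qed
  note one = this
  have "red n (B (lc (g t) 0 1 0 0)) = red n (B (lc (g t) (- 1) 0 1 0))"
    unfolding red_eq_iff lc_diff dv_def[symmetric] using one by simp
  then have "w (A (lc (g t) 1 0 0 0)) (B (lc (g t) (- 1) 0 1 0)) = 8" using v(1) cong by metis
  note eq = this[unfolded w_def, simplified, unfolded nadd_def]
  have "of_bool (dv n (g t) 5 0 1 0) \<le> (1::nat)" "of_bool (dv n (g t) 5 0 3 0) \<le> (1::nat)" by simp_all
  then show False using eq by linarith
qed

private lemma even_walks_twin_C:
  assumes v: "w (A (lc (g t) 1 0 0 0)) (C (lc (g t) 0 1 0 0)) = 8" "odd (w (A (lc (g t) (- 1) 0 0 0)) (C (lc (g t) 0 1 0 0)))"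
  shows False
proof -
  note [simp] = walks_simps six six'
  have cong: "w u v = w u v'" if "red n v = red n v'" for u v v'
    unfolding w_def by (rule walks_target_cong[OF that])
  have "dv n (g t) 1 1 1 0"
  proof (rule ccontr)
    assume none: "\<not> ?thesis"
    define m where "m = w (A (lc (g t) (- 1) 0 0 0)) (C (lc (g t) 0 1 0 0))"
    have none': "of_bool (dv n (g t) 1 1 1 0) = (0::nat)"
      using none by simp_all
    have "m = 2 * (6 * of_bool (dv n (g t) 0 1 0 0) + 6 * of_bool (dv n (g t) 0 1 2 0) + 2 * of_bool (dv n (g t) 1 (- 1) 1 0) + of_bool (dv n (g t) 1 (- 1) 3 0) + 2 * of_bool (dv n (g t) 1 1 1 0) + 6 * of_bool (dv n (g t) 1 1 3 0) + of_bool (dv n (g t) 2 (- 1) 0 0) + of_bool (dv n (g t) 2 (- 1) 2 0) + 6 * of_bool (dv n (g t) 2 1 0 0) + 6 * of_bool (dv n (g t) 2 1 2 0) + of_bool (dv n (g t) 3 1 1 0) + 2 * of_bool (dv n (g t) 3 1 3 0) + of_bool (dv n (g t) 4 1 0 0) + of_bool (dv n (g t) 4 1 2 0))"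
      using m_def[symmetric, unfolded w_def, simplified, unfolded nadd_def] none' by (simp del: walks_simps)
    then have "even m" by (simp only: dvd_triv_left)
    then show False using v(2) unfolding m_def by blast
  qed
  note one = this
  have "red n (C (lc (g t) 0 1 0 0)) = red n (C (lc (g t) (- 1) 0 3 0))"
    unfolding red_eq_iff lc_diff dv_def[symmetric] using one by simp
  then have "w (A (lc (g t) 1 0 0 0)) (C (lc (g t) (- 1) 0 3 0)) = 8" using v(1) cong by metis
  note eq = this[unfolded w_def, simplified, unfolded nadd_def]
  have "of_bool (dv n (g t) 5 0 1 0) \<le> (1::nat)" "of_bool (dv n (g t) 5 0 3 0) \<le> (1::nat)" by simp_all
  then show False using eq by linarith
qed

lemma even_walks_twin:
  assumes v: "walks n a (2 * z + a) (2 * z - a) z (Suc (Suc (Suc (Suc 0)))) (A a) v = 8"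
  shows "even (walks n a (2 * z + a) (2 * z - a) z (Suc (Suc (Suc (Suc 0)))) (A (- a)) v)"
  unfolding w_def[symmetric]
proof (rule ccontr)
  assume odd: "odd (w (A (- a)) v)"
  note v = v[folded w_def]
  have a: "lc (g t) 1 0 0 0 = a" "lc (g t) (- 1) 0 0 0 = - a" "lc (g t) 0 1 0 0 = t" for t
    by (simp_all add: g_def lc_def)
  show False
    using even_walks_twin_A even_walks_twin_B even_walks_twin_C v odd unfolding a by (cases v) blast+
qed

text \<open>\<open>C (2 * z)\<close> is the witness that separates the pair \<open>B 0\<close>,
  \<open>C 0\<close> from \<open>A (- a)\<close>, \<open>A a\<close>: eight walks from
  \<open>C 0\<close>, an odd number from \<open>B 0\<close>.\<close>

lemma walks_twin:
  "walks n a (2 * z + a) (2 * z - a) z (Suc (Suc (Suc (Suc 0)))) (C 0) (C (2 * z)) = 8"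
  "walks n a (2 * z + a) (2 * z - a) z (Suc (Suc (Suc (Suc 0)))) (B 0) (C (2 * z)) = 5"
proof -
  note [simp] = walks_simps six six'
  have "w (C (lc (g 0) 0 0 0 0)) (C (lc (g 0) 0 0 2 0)) = 8" "w (B (lc (g 0) 0 0 0 0)) (C (lc (g 0) 0 0 2 0)) = 5"
    unfolding w_def by (simp, simp add: nadd_def)+
  moreover have "lc (g 0) 0 0 0 0 = 0" "lc (g 0) 0 0 2 0 = 2 * z" by (simp_all add: g_def lc_def)
  ultimately show
    "walks n a (2 * z + a) (2 * z - a) z (Suc (Suc (Suc (Suc 0)))) (C 0) (C (2 * z)) = 8"
    "walks n a (2 * z + a) (2 * z - a) z (Suc (Suc (Suc (Suc 0)))) (B 0) (C (2 * z)) = 5"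
    unfolding w_def by simp_all
qed

end

text \<open>Automorphisms permute the range of \<open>y\<close>, so the existence of a suitable
  \<open>y\<close> is invariant; adding both orders of \<open>u\<close> and \<open>v\<close> makes
  the weight symmetric.\<close>

lemma invariant_weight_ex:
  assumes inv: "invariant_weight V E h"
  shows "invariant_weight V E (\<lambda>u v. of_bool (\<exists>y\<in>V. R (h v y) (h u y)) + of_bool (\<exists>y\<in>V. R (h u y) (h v y)))"
proof -
  have *: "(\<exists>y\<in>V. R (h (g v) y) (h (g u) y)) \<longleftrightarrow> (\<exists>y\<in>V. R (h v y) (h u y))"
    if g: "g \<in> graph_auts V E" and "u \<in> V" "v \<in> V" for g u v
  proof -
    have "g ` V = V" using graph_autsD(1)[OF g] by (simp add: bij_betw_def)
    then have "(\<exists>y\<in>V. R (h (g v) y) (h (g u) y)) \<longleftrightarrow> (\<exists>y\<in>V. R (h (g v) (g y)) (h (g u) (g y)))"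
      by (metis imageE imageI)
    also have "\<dots> \<longleftrightarrow> (\<exists>y\<in>V. R (h v y) (h u y))"
      using inv that unfolding invariant_weight_def by (metis (no_types, lifting))
    finally show ?thesis .
  qed
  show ?thesis
    unfolding invariant_weight_def using * by (auto simp: add.commute)
qed

lemma walks_swap:
  "walks n (- a) b c d k u v = walks n a b c d k u v"
  "walks n a c b d k u v = walks n a b c d k u v"
proof (induction k arbitrary: u)
  case 0
  { case 1 then show ?case by (simp add: walks.simps) }
  { case 2 then show ?case by (simp add: walks.simps) }
next
  case (Suc k)
  { case 1 then show ?case using Suc by (cases u) (simp_all add: walks.simps) }
  { case 2 then show ?case using Suc by (cases u) (simp_all add: walks.simps) }
qed

lemma no_twin_family:
  assumes H: "WH_edge_trans n a (2 * z + a) (2 * z - a) z"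
    and z: "n dvd 4 * z" and az: "\<not> n dvd 4 * a - 2 * z"
  shows False
proof -
  let ?V = "WH_verts n" and ?E = "WH_edges n a (2 * z + a) (2 * z - a) z"
  let ?k = "Suc (Suc (Suc (Suc 0)))"
  let ?w = "walks n a (2 * z + a) (2 * z - a) z ?k"
  define h where "h = gwalks ?V ?E ?k"
  define f where "f u v = of_bool (\<exists>y\<in>?V. h v y = 8 \<and> odd (h u y)) + (of_bool (\<exists>y\<in>?V. h u y = 8 \<and> odd (h v y)) :: nat)" for u v
  have fin: "finite ?V" by (simp add: WH_verts_def)
  have h: "h (red n u) (red n v) = ?w u v" for u v
    unfolding h_def by (rule gwalks_red[OF H])
  have redV: "red n y = y" if "y \<in> ?V" for y using that by (auto simp: WH_verts_def)
  have inV: "red n u \<in> ?V" for u using H by (cases u) (auto simp: WH_verts_def WH_edge_trans_def)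
  \<comment> \<open>The family is stable under negating \<open>a\<close>, so
    \<open>even_walks_twin\<close> also applies with \<open>A a\<close> and \<open>A (- a)\<close>
    exchanged.\<close>
  have H': "WH_edge_trans n (- a) (2 * z + - a) (2 * z - - a) z"
    using WH_edge_trans_swap(1)[OF WH_edge_trans_swap(3)[OF H]] by simp
  have az': "\<not> n dvd 4 * - a - 2 * z"
  proof
    assume "n dvd 4 * - a - 2 * z"
    from dvd_add[OF this z] have "n dvd - (4 * a - 2 * z)" by (simp add: algebra_simps)
    then show False using az by (simp only: dvd_minus_iff)
  qed
  have w': "walks n (- a) (2 * z + - a) (2 * z - - a) z k u v = walks n a (2 * z + a) (2 * z - a) z k u v" for k u v
    using walks_swap(1)[of n a "2 * z - a" "2 * z + a" z k u v] walks_swap(2)[of n a "2 * z - a" "2 * z + a" z k u v]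
    by simp
  have "invariant_weight ?V ?E f"
    unfolding f_def h_def by (rule invariant_weight_ex[OF invariant_weight_gwalks[OF fin]])
  then have "f (red n (A (- a))) (red n (A a)) = f (red n (B 0)) (red n (C 0))"
    by (rule local_weights(1)[OF H])
  moreover have "f (red n (B 0)) (red n (C 0)) \<noteq> 0"
  proof -
    have "h (red n (C 0)) (red n (C (2 * z))) = 8 \<and> odd (h (red n (B 0)) (red n (C (2 * z))))"
      unfolding h walks_twin[OF H z az] by simp
    then have "\<exists>y\<in>?V. h (red n (C 0)) y = 8 \<and> odd (h (red n (B 0)) y)" using inV by blast
    then show ?thesis unfolding f_def by simp
  qed
  moreover have "f (red n (A (- a))) (red n (A a)) = 0"
  proof -
    have "even (h (red n (A (- a))) y)" if "y \<in> ?V" "h (red n (A a)) y = 8" for y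
      using even_walks_twin[OF H z az, of y] that h[of _ y] redV by metis
    moreover have "even (h (red n (A a)) y)" if "y \<in> ?V" "h (red n (A (- a))) y = 8" for y
      using even_walks_twin[OF H' z az', of y, unfolded w' minus_minus] that h[of _ y] redV by metis
    ultimately show ?thesis unfolding f_def by auto
  qed
  ultimately show False by simp
qed

section \<open>Elimination of the relations for an opposite pair\<close>

lemma no_double_opposite_pair:
  assumes H: "WH_edge_trans n a x (- x) z" and e: "n dvd 2 * a - 2 * x"
  shows False
proof -
  define h where "h = x - a"
  have h: "n dvd 2 * h" using e by (simp add: h_def algebra_simps dvd_diff_commute)
  have h0: "\<not> n dvd h" using edge_trans_no_short_cycles[OF H] by (simp add: h_def no_short_cycles_def)
  have H1: "WH_edge_trans n a (h + a) (h - a) z"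
    by (rule WH_edge_trans_cong[OF H]) (use e in \<open>simp_all add: h_def algebra_simps\<close>)
  have zh: "n dvd 2 * z - h" and ah: "\<not> n dvd 4 * a - h"
    using involution_family[OF H1 h h0] by auto
  have H2: "WH_edge_trans n a (2 * z + a) (2 * z - a) z"
    by (rule WH_edge_trans_cong[OF H1]) (use zh in \<open>simp_all add: dvd_diff_commute\<close>)
  have "n dvd 4 * z"
    using dvd_add[OF dvd_mult[OF zh, of 2] h] by (simp add: algebra_simps)
  moreover have "\<not> n dvd 4 * a - 2 * z"
    using ah dvd_add[OF _ zh, of "4 * a - 2 * z"] by auto
  ultimately show False using no_twin_family[OF H2] by blast
qed

text \<open>Negating \<open>x\<close> only swaps two parameters and negating \<open>a\<close> leaves
  the graph unchanged, so the eight relations reduce to \<open>z = 3 * a\<close>,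
  \<open>z = x + 2 * a\<close> and \<open>2 * a = 2 * x\<close>.\<close>

lemma no_opposite_pair:
  assumes H: "WH_edge_trans n a x (- x) z"
  shows False
proof -
  have H1: "WH_edge_trans n a (- x) (- (- x)) z" using WH_edge_trans_swap(1)[OF H] by simp
  have H2: "WH_edge_trans n (- a) x (- x) z" by (rule WH_edge_trans_swap(3)[OF H])
  have H3: "WH_edge_trans n (- a) (- x) (- (- x)) z" by (rule WH_edge_trans_swap(3)[OF H1])
  have triple: False if "WH_edge_trans n a x (- x) z" "n dvd z - 3 * a" for a x
  proof -
    have "WH_edge_trans n a x (- x) (3 * a)" using WH_edge_trans_cong[OF that(1), of a x "- x"] that(2) by simp
    then show False by (rule no_triple_opposite_pair)
  qed
  have shifted: False if "WH_edge_trans n a x (- x) z" "n dvd z - (x + 2 * a)" for a x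
  proof -
    have "WH_edge_trans n a x (- x) (x + 2 * a)" using WH_edge_trans_cong[OF that(1), of a x "- x"] that(2) by simp
    then show False by (rule no_shifted_opposite_pair)
  qed
  have neg: "n dvd u" if "n dvd v" "u = - v" for u v :: int using that by simp
  from opposite_pair_cases[OF H] show False
  proof (elim disjE)
    assume e: "n dvd 3 * a - z"
    show False by (rule triple[OF H]) (rule neg[OF e], simp)
  next
    assume e: "n dvd 3 * a + z"
    show False by (rule triple[OF H2]) (use e in \<open>simp add: algebra_simps\<close>)
  next
    assume e: "n dvd 2 * a - 2 * x"
    then show False by (rule no_double_opposite_pair[OF H])
  next
    assume e: "n dvd 2 * a + 2 * x"
    then show False by (intro no_double_opposite_pair[OF H1]) simp
  next
    assume e: "n dvd 2 * a - x + z"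
    show False by (rule shifted[OF H2]) (use e in \<open>simp add: algebra_simps\<close>)
  next
    assume e: "n dvd 2 * a - x - z"
    show False by (rule shifted[OF H1]) (rule neg[OF e], simp)
  next
    assume e: "n dvd 2 * a + x + z"
    show False by (rule shifted[OF H3]) (use e in \<open>simp add: algebra_simps\<close>)
  next
    assume e: "n dvd 2 * a + x - z"
    show False by (rule shifted[OF H]) (rule neg[OF e], simp)
  qed
qed

theorem theorem3p7:
  fixes n a b c d :: int
  assumes "WH_params n a b c d"
  shows "\<not> edge_transitive (WH_verts n) (WH_edges n a b c d)"
proof
  assume "edge_transitive (WH_verts n) (WH_edges n a b c d)"
  then have H: "WH_edge_trans n a b c d"
    using assms simple_graph_WH[OF assms]
    by (auto simp: WH_edge_trans_def WH_params_def cong_iff_dvd_diff)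
  have opp: False if "WH_edge_trans n a b c d" "n dvd b + c" for b c d
  proof -
    have "n dvd c - (- b)" using that(2) by (simp add: add.commute)
    then have "WH_edge_trans n a b (- b) d" using WH_edge_trans_cong[OF that(1), of a b "- b" d] by simp
    then show False by (rule no_opposite_pair)
  qed
  \<comment> \<open>A permutation of \<open>b\<close>, \<open>c\<close>, \<open>d\<close> moves the
    opposite pair to the front.\<close>
  from opposite_pair[OF H] show False
  proof (elim disjE)
    assume "n dvd b + c"
    then show False using opp H by blast
  next
    assume "n dvd b + d"
    then show False using opp[OF WH_edge_trans_swap(2)[OF H]] by blast
  next
    assume "n dvd c + d"
    then show False using opp[OF WH_edge_trans_swap(2)[OF WH_edge_trans_swap(1)[OF H]]] by blast
  qed
qed

end
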